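(* Let $n\ge1$ and $\eta(\xi)=\dfrac{|\xi|^2}{(1+|\xi|^2)^2}$ for $\xi\in\mathbb{R}^n$. Let $1\le q,r\le 2\le p\le\infty$, and let $j,k,\ell$ be non-negative integers with $0\le j\le k$ and $\ell>n\left(\frac1r-\frac1p\right)$ (in the case $p=r=2$ it is only required that $\ell\ge0$). Then there is a constant $C>0$ such that for all $\phi\in\mathcal{S}(\mathbb{R}^n)$ and all $t\ge0$, $$\left\|\mathcal{F}^{-1}\left[|\xi|^{k}e^{-\eta(\xi)t}|\hat\phi(\xi)|\right]\right\|_{L^p}\le C(1+t)^{-\gamma_{2}(q,p)-\frac{k-j}{2}}\|\partial_x^j\phi\|_{L^q}+C(1+t)^{-\frac{\ell}{2}+\gamma_{2}(r,p)}\|\partial_x^{k+\ell}\phi\|_{L^r}.$$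
   Context: $\gamma_2(q,p):=\frac{n}{2}\left(\frac1q-\frac1p\right)$. $\mathcal{S}(\mathbb{R}^n)$ is the Schwartz class, $\hat\phi(\xi)=\mathcal{F}[\phi](\xi)=\int_{\mathbb{R}^n}\phi(x)e^{-2\pi i x\cdot\xi}\,dx$ is the Fourier transform and $\mathcal{F}^{-1}$ its inverse. $\|\partial_x^m\phi\|_{L^r}$ denotes the $L^r$ norm of the collection of all partial derivatives of $\phi$ of order $m$. All $L^p$ norms are over $\mathbb{R}^n$. *)

theory Defs
  imports "HOL-Analysis.Analysis" "HOL-Probability.Essential_Supremum"
begin

text \<open>
  \<open>\<real>\<^sup>n\<close> is \<^typ>\<open>real ^ 'n\<close>, with \<open>n = CARD('n)\<close>. Exponents are extended nonnegative reals, so that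
  \<open>1 / \<infinity> = 0\<close>, and norms take values in \<^typ>\<open>ennreal\<close>, so that an upper bound on a norm
  includes its finiteness.
\<close>

definition Lp_norm :: "ennreal \<Rightarrow> (real ^ 'n \<Rightarrow> 'b::real_normed_vector) \<Rightarrow> ennreal" where
  "Lp_norm p f =
     (if p = \<infinity> then esssup lborel (\<lambda>x. ennreal (norm (f x)))
      else let I = (\<integral>\<^sup>+ x. ennreal (norm (f x) powr enn2real p) \<partial>lborel)
           in if I = \<infinity> then \<infinity> else ennreal (enn2real I powr (1 / enn2real p)))"

definition partial_deriv :: "'n \<Rightarrow> (real ^ 'n \<Rightarrow> complex) \<Rightarrow> real ^ 'n \<Rightarrow> complex" where
  "partial_deriv i f x = vector_derivative (\<lambda>s. f (x + s *\<^sub>R axis i 1)) (at 0)"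

fun partial_derivs :: "'n list \<Rightarrow> (real ^ 'n \<Rightarrow> complex) \<Rightarrow> real ^ 'n \<Rightarrow> complex" where
  "partial_derivs [] f = f"
| "partial_derivs (i # is) f = partial_deriv i (partial_derivs is f)"

text \<open>
  A function is smooth iff all its iterated partial derivatives are differentiable; each of them is
  then continuous.
\<close>

definition schwartz :: "(real ^ 'n \<Rightarrow> complex) set" where
  "schwartz = {f. (\<forall>is x. partial_derivs is f differentiable (at x)) \<and>
                  (\<forall>(\<alpha>::'n \<Rightarrow> nat) is.
                     bounded (range (\<lambda>x. (\<Prod>i\<in>UNIV. (x $ i) ^ \<alpha> i) *\<^sub>R partial_derivs is f x)))}"

text \<open>
  The collection of all partial derivatives of order \<open>m\<close> is the family of all
  \<open>\<partial>\<^bsub>i\<^sub>1\<^esub> \<dots> \<partial>\<^bsub>i\<^sub>m\<^esub> f\<close>, measured pointwise in the Euclidean norm. Indexing by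
  multi-indices of order \<open>m\<close> instead changes the norm only by factors depending on \<open>n\<close> and \<open>m\<close>.
\<close>

definition deriv_norm :: "nat \<Rightarrow> (real ^ 'n \<Rightarrow> complex) \<Rightarrow> real ^ 'n \<Rightarrow> real" where
  "deriv_norm m f x = L2_set (\<lambda>is. norm (partial_derivs is f x)) {is. length is = m}"

definition fourier :: "(real ^ 'n \<Rightarrow> complex) \<Rightarrow> real ^ 'n \<Rightarrow> complex" where
  "fourier f \<xi> = (\<integral>x. f x * exp (- 2 * of_real pi * \<i> * of_real (x \<bullet> \<xi>)) \<partial>lborel)"

definition inv_fourier :: "(real ^ 'n \<Rightarrow> complex) \<Rightarrow> real ^ 'n \<Rightarrow> complex" where
  "inv_fourier g x = (\<integral>\<xi>. g \<xi> * exp (2 * of_real pi * \<i> * of_real (x \<bullet> \<xi>)) \<partial>lborel)"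

definition eta :: "real ^ 'n \<Rightarrow> real" where
  "eta \<xi> = (norm \<xi>)\<^sup>2 / (1 + (norm \<xi>)\<^sup>2)\<^sup>2"

definition gamma2 :: "nat \<Rightarrow> ennreal \<Rightarrow> ennreal \<Rightarrow> real" where
  "gamma2 n q p = real n / 2 * (enn2real (1 / q) - enn2real (1 / p))"

end

theory Submission
  imports Defs "HOL-Probability.Characteristic_Functions"
begin

text \<open>
  The multiplier \<open>exp (- eta \<xi> * t)\<close> decays in \<open>t\<close> because \<open>eta\<close> is positive away from the
  origin, but \<open>eta\<close> degenerates both at \<open>\<xi> = 0\<close>, where \<open>eta \<xi> \<ge> |\<xi>|\<^sup>2 / 4\<close>, and at infinity, where
  \<open>eta \<xi> \<ge> 1 / (4 |\<xi>|\<^sup>2)\<close>. The two terms on the right-hand side are the contributions of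
  \<open>|\<xi>| \<le> 1\<close> and of \<open>|\<xi>| > 1\<close>. For small frequencies one writes \<open>|\<xi>|^k = |\<xi>|^(k-j) |\<xi>|^j\<close> and
  \<open>exp (- t |\<xi>|\<^sup>2 / 4)\<close> acts as the heat semigroup. For large frequencies one writes
  \<open>|\<xi>|^k = |\<xi>|^(-l) |\<xi>|^(k+l)\<close>: the factor \<open>|\<xi>|^(-l) exp (- t / (4 |\<xi>|\<^sup>2))\<close>, which costs \<open>l\<close>
  additional derivatives of \<open>\<phi>\<close>, is small unless \<open>|\<xi>|\<^sup>2\<close> is at least comparable to \<open>t\<close>,
  where its first part gains \<open>t\<^bsup>- l/2\<^esup>\<close>.

  Let \<open>p'\<close>, \<open>q'\<close>, \<open>r'\<close> be the dual exponents. The Hausdorff-Young inequality for the inverse transform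
  bounds the \<open>L\<^sup>p\<close> norm by the \<open>L\<^bsup>p'\<^esup>\<close> norm of the symbol; this uses only \<open>|fourier \<phi>|\<close>, so it
  is harmless that the statement discards the phase. Hoelder's inequality with
  \<open>1/p' = (1/q - 1/p) + 1/q'\<close> separates the multiplier from \<open>|\<xi>|^j |fourier \<phi>|\<close>, and the
  Hausdorff-Young inequality, applied to the derivatives of \<open>\<phi>\<close> of order \<open>j\<close>, bounds the latter by
  the norm of these derivatives (lemma \<open>weighted_fourier_Lp_le\<close>). The powers of \<open>1 + t\<close> come from
  rescaling \<open>\<xi>\<close> by \<open>(1 + t)\<^bsup>1/2\<^esup>\<close> in the norms of the multipliers (lemmas
  \<open>low_multiplier_Lp_le\<close> and \<open>high_multiplier_Lp_le\<close>). The condition on \<open>l\<close> is what makes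
  \<open>|\<xi>|^(-l)\<close> belong, near infinity, to the Lebesgue space with reciprocal exponent \<open>1/r - 1/p\<close>.

  Since constants are irrelevant, the Hausdorff-Young inequality is obtained by Marcinkiewicz
  interpolation between the trivial bound from \<open>L\<^sup>1\<close> to \<open>L\<^sup>\<infinity>\<close> and Plancherel's inequality on
  \<open>L\<^sup>1 \<inter> L\<^sup>2\<close>, which in turn follows from the fact that the Fourier transform of a Gaussian is a
  nonnegative approximate identity.
\<close>

section \<open>Bounds in Lebesgue spaces, indexed by the reciprocal exponent\<close>

text \<open>
  Membership in a Lebesgue space with an explicit bound on the norm. The index is the reciprocal
  \<open>u = 1/p\<close> of the exponent, with \<open>u = 0\<close> for \<open>p = \<infinity>\<close>, because the exponents in the inequalities of
  Hoelder (\<open>u + v\<close>) and Hausdorff-Young (\<open>1 - u\<close>) are affine in it. Bounding the norm instead of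
  naming it keeps all constants real, and measurability is included because it is needed at each use.
\<close>

definition Lp_le :: "real \<Rightarrow> (real ^ 'n \<Rightarrow> 'b::real_normed_vector) \<Rightarrow> real \<Rightarrow> bool" where
  "Lp_le u f c \<longleftrightarrow> f \<in> borel_measurable borel \<and> 0 \<le> c \<and>
     (if u = 0 then AE x in lborel. norm (f x) \<le> c
      else (\<integral>\<^sup>+x. ennreal (norm (f x) powr (1 / u)) \<partial>lborel) \<le> ennreal (c powr (1 / u)))"

lemma Lp_le_measurable: "Lp_le u f c \<Longrightarrow> f \<in> borel_measurable borel"
  and Lp_le_nonneg: "Lp_le u f c \<Longrightarrow> 0 \<le> c"
  and Lp_le_0_AE: "Lp_le 0 f c \<Longrightarrow> AE x in lborel. norm (f x) \<le> c"
  and Lp_le_integral: "Lp_le u f c \<Longrightarrow> u > 0 \<Longrightarrow>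
        (\<integral>\<^sup>+x. ennreal (norm (f x) powr (1 / u)) \<partial>lborel) \<le> ennreal (c powr (1 / u))"
  by (auto simp: Lp_le_def)

lemma Lp_le_mono:
  fixes f :: "real ^ 'n \<Rightarrow> 'b::real_normed_vector" and g :: "real ^ 'n \<Rightarrow> 'c::real_normed_vector"
  assumes g: "Lp_le u g c" and f: "f \<in> borel_measurable borel"
    and le: "\<And>x. norm (f x) \<le> norm (g x)" and cd: "c \<le> d" and u: "0 \<le> u"
  shows "Lp_le u f d"
proof (cases "u = 0")
  case True
  have "AE x in lborel. norm (f x) \<le> d"
    using Lp_le_0_AE[OF g[unfolded True]] by eventually_elim (meson le cd order_trans)
  then show ?thesis using True f g cd by (auto simp: Lp_le_def)
next
  case False
  with u have u: "u > 0" by simp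
  have "(\<integral>\<^sup>+x. ennreal (norm (f x) powr (1 / u)) \<partial>lborel) \<le> (\<integral>\<^sup>+x. ennreal (norm (g x) powr (1 / u)) \<partial>lborel)"
    using u le by (intro nn_integral_mono ennreal_leI powr_mono2) auto
  also have "\<dots> \<le> ennreal (c powr (1 / u))" using Lp_le_integral[OF g u] .
  also have "\<dots> \<le> ennreal (d powr (1 / u))"
    using u cd Lp_le_nonneg[OF g] by (intro ennreal_leI powr_mono2) auto
  finally show ?thesis using u f Lp_le_nonneg[OF g] cd by (auto simp: Lp_le_def)
qed

lemma Lp_le_cmult:
  fixes f :: "real ^ 'n \<Rightarrow> 'b::real_normed_vector"
  assumes f: "Lp_le u f c" and u: "0 \<le> u"
  shows "Lp_le u (\<lambda>x. a * norm (f x)) (\<bar>a\<bar> * c)"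
proof (cases "u = 0")
  case True
  have "AE x in lborel. norm (a * norm (f x)) \<le> \<bar>a\<bar> * c"
    using Lp_le_0_AE[OF f[unfolded True]] by eventually_elim (auto simp: abs_mult intro: mult_left_mono)
  then show ?thesis using True f by (auto simp: Lp_le_def)
next
  case False
  with u have u: "u > 0" by simp
  have [measurable]: "f \<in> borel_measurable borel" using Lp_le_measurable[OF f] .
  have "(\<integral>\<^sup>+x. ennreal (norm (a * norm (f x)) powr (1 / u)) \<partial>lborel)
     = (\<integral>\<^sup>+x. ennreal (\<bar>a\<bar> powr (1 / u)) * ennreal (norm (f x) powr (1 / u)) \<partial>lborel)"
    by (simp add: abs_mult powr_mult ennreal_mult)
  also have "\<dots> = ennreal (\<bar>a\<bar> powr (1 / u)) * (\<integral>\<^sup>+x. ennreal (norm (f x) powr (1 / u)) \<partial>lborel)"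
    by (rule nn_integral_cmult) measurable
  also have "\<dots> \<le> ennreal (\<bar>a\<bar> powr (1 / u)) * ennreal (c powr (1 / u))"
    using Lp_le_integral[OF f u] by (intro mult_left_mono) auto
  also have "\<dots> = ennreal ((\<bar>a\<bar> * c) powr (1 / u))"
    using Lp_le_nonneg[OF f] by (simp add: ennreal_mult powr_mult)
  finally show ?thesis using u Lp_le_nonneg[OF f] by (auto simp: Lp_le_def)
qed

lemma Lp_le_zero_AE:
  fixes f :: "real ^ 'n \<Rightarrow> 'b::real_normed_vector"
  assumes f: "Lp_le u f 0" and u: "0 \<le> u"
  shows "AE x in lborel. f x = 0"
proof (cases "u = 0")
  case True
  then show ?thesis using Lp_le_0_AE f by force
next
  case False
  with u have u: "u > 0" by simp
  have [measurable]: "f \<in> borel_measurable borel" using Lp_le_measurable[OF f] .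
  have "(\<integral>\<^sup>+x. ennreal (norm (f x) powr (1 / u)) \<partial>lborel) = 0"
    using Lp_le_integral[OF f u] by simp
  then have "AE x in lborel. ennreal (norm (f x) powr (1 / u)) = 0"
    by (subst (asm) nn_integral_0_iff_AE) auto
  then show ?thesis by eventually_elim (auto simp: ennreal_eq_0_iff)
qed

lemma Lp_le_AE_zeroI:
  fixes f :: "real ^ 'n \<Rightarrow> 'b::real_normed_vector"
  assumes "f \<in> borel_measurable borel" "AE x in lborel. f x = 0" "0 \<le> c" 
  shows "Lp_le u f c"
proof -
  have "(\<integral>\<^sup>+x. ennreal (norm (f x) powr (1 / u)) \<partial>lborel) = (\<integral>\<^sup>+x. 0 \<partial>(lborel::(real^'n) measure))"
    using assms(2) by (intro nn_integral_cong_AE) (auto elim!: eventually_mono)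
  moreover have "AE x in lborel. norm (f x) \<le> c"
    using assms(2) by eventually_elim (use assms(3) in auto)
  ultimately show ?thesis using assms by (simp add: Lp_le_def)
qed

text \<open>
  Both summands are compared with \<open>(a + b) powr (P - 1)\<close> after splitting off one factor.
\<close>

lemma powr_superadditive:
  fixes a b P :: real
  assumes "0 \<le> a" "0 \<le> b" "1 \<le> P"
  shows "a powr P + b powr P \<le> (a + b) powr P"
proof -
  have *: "x powr P = x * x powr (P - 1)" if "0 \<le> x" for x
    using that by (cases "x = 0") (auto simp: powr_diff)
  have "a powr P + b powr P \<le> a * (a + b) powr (P - 1) + b * (a + b) powr (P - 1)"
    unfolding *[OF assms(1)] *[OF assms(2)] using assms
    by (intro add_mono mult_left_mono powr_mono2) auto
  also have "\<dots> = (a + b) powr P" using *[of "a + b"] assms by (simp add: algebra_simps)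
  finally show ?thesis .
qed

text \<open>
  A crude form of Minkowski's inequality: the factor 2 comes from \<open>x + y \<le> 2 * max x y\<close>, and the
  sum of the two integrals is absorbed by superadditivity of \<open>P\<close>-th powers.
\<close>

lemma Lp_le_add:
  fixes f :: "real ^ 'n \<Rightarrow> 'b::real_normed_vector" and g :: "real ^ 'n \<Rightarrow> 'c::real_normed_vector"
  assumes f: "Lp_le u f a" and g: "Lp_le u g b" and u: "0 \<le> u" "u \<le> 1"
  shows "Lp_le u (\<lambda>x. norm (f x) + norm (g x)) (2 * (a + b))"
proof -
  have [measurable]: "f \<in> borel_measurable borel" "g \<in> borel_measurable borel"
    using Lp_le_measurable[OF f] Lp_le_measurable[OF g] .
  have ab: "0 \<le> a" "0 \<le> b" using Lp_le_nonneg[OF f] Lp_le_nonneg[OF g] .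
  show ?thesis
  proof (cases "u = 0")
    case True
    have "AE x in lborel. norm (norm (f x) + norm (g x)) \<le> 2 * (a + b)"
      using Lp_le_0_AE[OF f[unfolded True]] Lp_le_0_AE[OF g[unfolded True]]
      by eventually_elim (use ab in auto)
    then show ?thesis using True ab by (simp add: Lp_le_def)
  next
    case False
    with u have u: "u > 0" "1 \<le> 1 / u" by auto
    define P where "P = 1 / u"
    have P: "1 \<le> P" using u P_def by simp
    have pt: "(x + y) powr P \<le> 2 powr P * (x powr P + y powr P)" if "0 \<le> x" "0 \<le> y" for x y :: real
    proof -
      have "(x + y) powr P \<le> (2 * max x y) powr P" using that P by (intro powr_mono2) auto
      also have "\<dots> = 2 powr P * max x y powr P" using that by (simp add: powr_mult)
      also have "\<dots> \<le> 2 powr P * (x powr P + y powr P)"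
        by (intro mult_left_mono) (auto simp: max_def)
      finally show ?thesis .
    qed
    have "(\<integral>\<^sup>+x. ennreal (norm (norm (f x) + norm (g x)) powr P) \<partial>lborel)
       \<le> (\<integral>\<^sup>+x. ennreal (2 powr P) * (ennreal (norm (f x) powr P) + ennreal (norm (g x) powr P)) \<partial>lborel)"
      using pt by (intro nn_integral_mono) (auto simp flip: ennreal_plus ennreal_mult)
    also have "\<dots> = ennreal (2 powr P) * ((\<integral>\<^sup>+x. ennreal (norm (f x) powr P) \<partial>lborel)
        + (\<integral>\<^sup>+x. ennreal (norm (g x) powr P) \<partial>lborel))"
      by (simp add: nn_integral_cmult nn_integral_add)
    also have "\<dots> \<le> ennreal (2 powr P) * (ennreal (a powr P) + ennreal (b powr P))"
      using Lp_le_integral[OF f u(1)] Lp_le_integral[OF g u(1)]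
      by (intro mult_left_mono add_mono) (auto simp: P_def)
    also have "\<dots> = ennreal (2 powr P * (a powr P + b powr P))"
      by (simp add: ennreal_mult flip: ennreal_plus)
    also have "\<dots> \<le> ennreal ((2 * (a + b)) powr P)"
      using powr_superadditive[OF ab P] ab
      by (intro ennreal_leI, subst powr_mult) auto
    finally show ?thesis using u ab by (simp add: Lp_le_def P_def)
  qed
qed

lemma Lp_le_sum:
  fixes f :: "'i \<Rightarrow> real ^ 'n \<Rightarrow> 'b::real_normed_vector"
  assumes "finite I" and u: "0 \<le> u" "u \<le> 1" and a: "0 \<le> a" and "\<And>i. i \<in> I \<Longrightarrow> Lp_le u (f i) a"
  shows "Lp_le u (\<lambda>x. \<Sum>i\<in>I. norm (f i x)) (4 ^ card I * a)"
  using assms(1,5)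
proof induction
  case empty
  then show ?case using a by (intro Lp_le_AE_zeroI) auto
next
  case (insert i I)
  have "Lp_le u (\<lambda>x. norm (f i x) + norm (\<Sum>i\<in>I. norm (f i x))) (2 * (a + 4 ^ card I * a))"
    using insert u by (intro Lp_le_add) auto
  moreover have "2 * (a + 4 ^ card I * a) \<le> 4 ^ card (insert i I) * a"
    using insert mult_right_mono[OF one_le_power[of "4::real" "card I"] a] by (simp add: algebra_simps)
  moreover have "(\<lambda>x. \<Sum>i\<in>insert i I. norm (f i x)) \<in> borel_measurable borel"
    using Lp_le_measurable[OF insert.prems] by measurable
  moreover have "norm (\<Sum>i\<in>insert i I. norm (f i x)) \<le> norm (norm (f i x) + norm (\<Sum>i\<in>I. norm (f i x)))" for x
    using insert.hyps by (simp add: sum_nonneg)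
  ultimately show ?case
    using Lp_le_mono u(1) by blast
qed

lemma Lp_le_normalized:
  fixes f :: "real ^ 'n \<Rightarrow> 'b::real_normed_vector"
  assumes f: "Lp_le u f c" and u: "0 < u" and c: "0 < c"
  shows "(\<integral>\<^sup>+x. ennreal ((norm (f x) / c) powr (1 / u)) \<partial>lborel) \<le> 1"
proof -
  have "Lp_le u (\<lambda>x. (1 / c) * norm (f x)) (\<bar>1 / c\<bar> * c)" 
    by (rule Lp_le_cmult) (use f u in auto)
  from Lp_le_integral[OF this u] show ?thesis using c by simp
qed

text \<open>
  After normalization Young's inequality bounds the integrand pointwise by a convex combination of
  the two normalized integrands. A factor in \<open>L\<^sup>\<infinity>\<close> or of norm zero has to be treated
  separately.
\<close>

lemma Lp_le_Holder:
  fixes f g :: "real ^ 'n \<Rightarrow> real"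
  assumes f: "Lp_le u f a" and g: "Lp_le v g b" and uv: "0 \<le> u" "0 \<le> v"
  shows "Lp_le (u + v) (\<lambda>x. f x * g x) (a * b)"
proof -
  have bounded_factor: "Lp_le v (\<lambda>x. f x * g x) (a * b)"
    if f: "Lp_le 0 f a" and g: "Lp_le v g b" and v: "0 \<le> v" for f g :: "real ^ 'n \<Rightarrow> real" and a b v
  proof -
    have [measurable]: "f \<in> borel_measurable borel" "g \<in> borel_measurable borel"
      using Lp_le_measurable[OF f] Lp_le_measurable[OF g] .
    have ab: "0 \<le> a" "0 \<le> b" using Lp_le_nonneg[OF f] Lp_le_nonneg[OF g] .
    have *: "Lp_le v (\<lambda>x. a * norm (g x)) (a * b)" using Lp_le_cmult[OF g v, of a] ab by simp
    have le: "AE x in lborel. norm (f x * g x) \<le> norm (a * norm (g x))"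
      using Lp_le_0_AE[OF f] by eventually_elim (use ab in \<open>auto simp: abs_mult intro: mult_right_mono\<close>)
    show ?thesis
    proof (cases "v = 0")
      case True
      have "AE x in lborel. norm (f x * g x) \<le> a * b"
        using le Lp_le_0_AE[OF *[unfolded True]] by eventually_elim auto
      then show ?thesis using True ab by (simp add: Lp_le_def)
    next
      case False
      with v have v: "v > 0" by simp
      have "(\<integral>\<^sup>+x. ennreal (norm (f x * g x) powr (1 / v)) \<partial>lborel)
          \<le> (\<integral>\<^sup>+x. ennreal (norm (a * norm (g x)) powr (1 / v)) \<partial>lborel)"
        using le by (intro nn_integral_mono_AE) (auto elim!: eventually_mono intro!: ennreal_leI powr_mono2 simp: v less_imp_le)
      also have "\<dots> \<le> ennreal ((a * b) powr (1 / v))" using Lp_le_integral[OF * v] .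
      finally show ?thesis using v ab by (simp add: Lp_le_def)
    qed
  qed
  have [measurable]: "f \<in> borel_measurable borel" "g \<in> borel_measurable borel"
    using Lp_le_measurable[OF f] Lp_le_measurable[OF g] .
  have ab: "0 \<le> a" "0 \<le> b" using Lp_le_nonneg[OF f] Lp_le_nonneg[OF g] .
  consider "u = 0" | "v = 0" | "a = 0" | "b = 0" | "0 < u" "0 < v" "0 < a" "0 < b"
    using uv ab by linarith
  then show ?thesis
  proof cases
    case 1 then show ?thesis using bounded_factor[of f a v g b] f g uv by simp
  next
    case 2 then show ?thesis using bounded_factor[of g b u f a] f g uv by (simp add: mult.commute)
  next
    case 3
    have "AE x in lborel. f x * g x = 0"
      using Lp_le_zero_AE[OF f[unfolded 3] uv(1)] by eventually_elim auto
    then show ?thesis using ab by (intro Lp_le_AE_zeroI) auto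
  next
    case 4
    have "AE x in lborel. f x * g x = 0"
      using Lp_le_zero_AE[OF g[unfolded 4] uv(2)] by eventually_elim auto
    then show ?thesis using ab by (intro Lp_le_AE_zeroI) auto
  next
    case 5
    define w where "w = u + v"
    define X where "X x = (\<bar>f x\<bar> / a) powr (1 / u)" for x
    define Y where "Y x = (\<bar>g x\<bar> / b) powr (1 / v)" for x
    have [measurable]: "X \<in> borel_measurable borel" "Y \<in> borel_measurable borel"
      by (auto simp: X_def[abs_def] Y_def[abs_def])
    have w: "w > 0" using 5 by (simp add: w_def)
    have pt: "norm (f x * g x) powr (1 / w) \<le> (a * b) powr (1 / w) * (u / w * X x + v / w * Y x)" for x
    proof (cases "f x = 0 \<or> g x = 0")
      case True
      then show ?thesis using 5 w by (auto simp: X_def Y_def)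
    next
      case False
      have "X x powr (u / w) * Y x powr (v / w) \<le> u / w * X x + v / w * Y x"
        using 5 w False by (intro Youngs_inequality_0) (auto simp: X_def Y_def w_def simp flip: add_divide_distrib)
      moreover have "norm (f x * g x) powr (1 / w) = (a * b) powr (1 / w) * (X x powr (u / w) * Y x powr (v / w))"
        using 5 w False by (simp add: X_def Y_def powr_powr abs_mult powr_mult powr_divide)
      ultimately show ?thesis using 5 by (simp add: mult_left_mono)
    qed
    have "(\<integral>\<^sup>+x. ennreal (norm (f x * g x) powr (1 / w)) \<partial>lborel)
      \<le> (\<integral>\<^sup>+x. ennreal ((a * b) powr (1 / w)) * (ennreal (u / w) * ennreal (X x) + ennreal (v / w) * ennreal (Y x)) \<partial>lborel)"
    proof (intro nn_integral_mono)
      fix x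
      have nn: "0 \<le> u / w" "0 \<le> v / w" "0 \<le> X x" "0 \<le> Y x" using 5 w by (auto simp: X_def Y_def)
      show "ennreal (norm (f x * g x) powr (1 / w)) \<le>
        ennreal ((a * b) powr (1 / w)) * (ennreal (u / w) * ennreal (X x) + ennreal (v / w) * ennreal (Y x))"
        using ennreal_leI[OF pt[of x]] nn by (simp only: ennreal_mult ennreal_plus mult_nonneg_nonneg add_nonneg_nonneg powr_ge_zero)
    qed
    also have "\<dots> = ennreal ((a * b) powr (1 / w)) *
        (ennreal (u / w) * (\<integral>\<^sup>+x. ennreal (X x) \<partial>lborel) + ennreal (v / w) * (\<integral>\<^sup>+x. ennreal (Y x) \<partial>lborel))"
      by (simp add: nn_integral_cmult nn_integral_add)
    also have "\<dots> \<le> ennreal ((a * b) powr (1 / w)) * (ennreal (u / w) * 1 + ennreal (v / w) * 1)"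
      using Lp_le_normalized[OF f] Lp_le_normalized[OF g] 5
      by (intro mult_left_mono add_mono) (auto simp: X_def Y_def)
    also have "\<dots> = ennreal ((a * b) powr (1 / w))"
      using 5 w by (simp flip: ennreal_plus add_divide_distrib) (simp add: w_def)
    finally show ?thesis using w ab by (simp add: Lp_le_def w_def)
  qed
qed

lemma nn_integral_lborel_scaleR:
  fixes f :: "real ^ 'n \<Rightarrow> ennreal"
  assumes [measurable]: "f \<in> borel_measurable borel" and c: "c \<noteq> 0"
  shows "(\<integral>\<^sup>+x. f (c *\<^sub>R x) \<partial>lborel) = ennreal (1 / \<bar>c\<bar> ^ CARD('n)) * (\<integral>\<^sup>+x. f x \<partial>lborel)"
proof -
  have "(\<integral>\<^sup>+x. f x \<partial>lborel) = ennreal (\<bar>c\<bar> ^ CARD('n)) * (\<integral>\<^sup>+x. f (c *\<^sub>R x) \<partial>lborel)"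
    using c by (subst lborel_affine[of c 0])
      (auto simp: nn_integral_density nn_integral_distr nn_integral_cmult)
  then show ?thesis using c
    by (simp add: mult.assoc[symmetric] flip: ennreal_mult)
qed

text \<open>
  A dilation multiplies the measure of the exceptional set by a finite factor, so a null set stays null.
\<close>

lemma AE_lborel_scaleR:
  fixes P :: "real ^ 'n \<Rightarrow> bool"
  assumes c: "c \<noteq> 0" and [measurable]: "Measurable.pred borel P" and ae: "AE x in lborel. P x"
  shows "AE x in lborel. P (c *\<^sub>R x)"
proof -
  have "(\<integral>\<^sup>+x. indicator {x. \<not> P x} x \<partial>(lborel :: (real ^ 'n) measure)) = 0"
    using ae by (subst nn_integral_0_iff_AE) (auto elim!: eventually_mono)
  then have "(\<integral>\<^sup>+x. indicator {x. \<not> P x} (c *\<^sub>R x) \<partial>(lborel :: (real ^ 'n) measure)) = 0"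
    using c by (subst nn_integral_lborel_scaleR) auto
  then show ?thesis
    by (subst (asm) nn_integral_0_iff_AE) (auto elim!: eventually_mono split: split_indicator_asm)
qed

text \<open>
  This homogeneity is the source of all powers of \<open>1 + t\<close> that depend on the dimension. The case
  \<open>c = -1\<close> also transfers estimates from \<open>fourier\<close> to \<open>inv_fourier\<close>.
\<close>

lemma Lp_le_scaleR:
  fixes f :: "real ^ 'n \<Rightarrow> 'b::real_normed_vector"
  assumes f: "Lp_le u f a" and c: "c \<noteq> 0" and u: "0 \<le> u"
  shows "Lp_le u (\<lambda>x. f (c *\<^sub>R x)) (\<bar>c\<bar> powr (- real CARD('n) * u) * a)"
proof -
  have [measurable]: "f \<in> borel_measurable borel" using Lp_le_measurable[OF f] .
  have a: "0 \<le> a" using Lp_le_nonneg[OF f] .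
  show ?thesis
  proof (cases "u = 0")
    case True
    have "AE x in lborel. norm (f (c *\<^sub>R x)) \<le> a"
      using c Lp_le_0_AE[OF f[unfolded True]] by (intro AE_lborel_scaleR[of c]) auto
    then show ?thesis using True a c by (simp add: Lp_le_def)
  next
    case False
    with u have u: "u > 0" by simp
    have "(\<integral>\<^sup>+x. ennreal (norm (f (c *\<^sub>R x)) powr (1 / u)) \<partial>lborel)
      = ennreal (1 / \<bar>c\<bar> ^ CARD('n)) * (\<integral>\<^sup>+x. ennreal (norm (f x) powr (1 / u)) \<partial>lborel)"
      using c by (intro nn_integral_lborel_scaleR[where f="\<lambda>x. ennreal (norm (f x) powr (1 / u))"]) auto
    also have "\<dots> \<le> ennreal (1 / \<bar>c\<bar> ^ CARD('n)) * ennreal (a powr (1 / u))"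
      using Lp_le_integral[OF f u] by (intro mult_left_mono) auto
    also have "\<dots> = ennreal ((\<bar>c\<bar> powr (- real CARD('n) * u) * a) powr (1 / u))"
      using c u a by (simp add: ennreal_mult[symmetric] powr_mult powr_divide powr_powr powr_minus_divide powr_realpow)
    finally show ?thesis using u a by (simp add: Lp_le_def)
  qed
qed

lemma Lp_norm_le:
  fixes f :: "real ^ 'n \<Rightarrow> 'b::real_normed_vector"
  assumes f: "Lp_le (enn2real (1 / p)) f c" and p: "1 \<le> p"
  shows "Lp_norm p f \<le> ennreal c"
proof (cases "p = \<infinity>")
  case True
  have [measurable]: "f \<in> borel_measurable borel" using Lp_le_measurable[OF f] .
  have "AE x in lborel. norm (f x) \<le> c" using f True by (intro Lp_le_0_AE) simp
  then show ?thesis using True 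
    by (auto simp: Lp_norm_def intro!: esssup_I ennreal_leI elim!: eventually_mono)
next
  case False
  then obtain P where P: "p = ennreal P" "P \<ge> 1"
    using p by (cases p) (auto simp flip: ennreal_1)
  have u: "enn2real (1 / p) = 1 / P" using P by (simp add: divide_ennreal flip: ennreal_1)
  let ?I = "\<integral>\<^sup>+x. ennreal (norm (f x) powr P) \<partial>lborel"
  have c: "0 \<le> c" using Lp_le_nonneg[OF f] .
  have I: "?I \<le> ennreal (c powr P)" using Lp_le_integral[OF f] P(2) unfolding u by simp
  have "?I \<noteq> \<infinity>" using I by (auto simp: top_unique)
  moreover have "enn2real ?I powr (1 / P) \<le> (c powr P) powr (1 / P)"
    using P I c by (intro powr_mono2) (auto simp: enn2real_leI)
  ultimately show ?thesis using False P c
    by (auto simp: Lp_norm_def Let_def powr_powr intro!: ennreal_leI)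
qed

lemma Lp_le_Lp_norm:
  fixes f :: "real ^ 'n \<Rightarrow> 'b::real_normed_vector"
  assumes [measurable]: "f \<in> borel_measurable borel" and p: "1 \<le> p" and fin: "Lp_norm p f \<noteq> \<infinity>"
  shows "Lp_le (enn2real (1 / p)) f (enn2real (Lp_norm p f))"
proof (cases "p = \<infinity>")
  case True
  have "Lp_norm p f = esssup lborel (\<lambda>x. ennreal (norm (f x)))" using True by (simp add: Lp_norm_def)
  then have "AE x in lborel. ennreal (norm (f x)) \<le> Lp_norm p f" by (simp add: esssup_AE)
  then have "AE x in lborel. norm (f x) \<le> enn2real (Lp_norm p f)"
  proof eventually_elim
    case (elim x)
    then show ?case using fin enn2real_mono[OF elim] by (simp add: top.not_eq_extremum)
  qed
  then show ?thesis using True by (simp add: Lp_le_def)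
next
  case False
  then obtain P where P: "p = ennreal P" "P \<ge> 1"
    using p by (cases p) (auto simp flip: ennreal_1)
  have u: "enn2real (1 / p) = 1 / P" using P by (simp add: divide_ennreal flip: ennreal_1)
  let ?I = "\<integral>\<^sup>+x. ennreal (norm (f x) powr P) \<partial>lborel"
  have I: "?I \<noteq> \<infinity>" using fin False P by (auto simp: Lp_norm_def Let_def)
  have L: "enn2real (Lp_norm p f) = enn2real ?I powr (1 / P)"
    using I False P by (auto simp: Lp_norm_def Let_def)
  have "?I = ennreal (enn2real ?I)" using I by (simp add: ennreal_enn2real_if)
  then show ?thesis unfolding Lp_le_def u L using P(2) by (simp add: powr_powr)
qed

section \<open>Integrable product weights\<close>

text \<open>
  A product weight that stands in for \<open>(1 + |x|\<^sup>2) powr (- b * n)\<close>: its integral factorizes by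
  Tonelli's theorem, without polar coordinates. By \<open>weight_ge\<close> it dominates the
  radial weight, with the exponents distributed evenly over the coordinates; this loses nothing in
  the range of integrability.
\<close>

definition weight :: "real \<Rightarrow> real ^ 'n \<Rightarrow> real" where
  "weight b x = (\<Prod>i\<in>UNIV. (1 + (x $ i)\<^sup>2) powr (- b))"

lemma weight_nonneg: "0 \<le> weight b x"
  unfolding weight_def by (intro prod_nonneg) simp

lemma borel_measurable_weight [measurable]: "weight b \<in> borel_measurable borel"
  unfolding weight_def[abs_def] cart_eq_inner_axis by measurable

text \<open>
  On the half line, \<open>(1 + x)\<^sup>2 \<le> 2 * (1 + x\<^sup>2)\<close> reduces the claim to a function with an explicit
  primitive; the other half line follows by reflection.
\<close>

lemma nn_integral_one_plus_square_powr:
  fixes b :: real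
  assumes b: "b > 1 / 2"
  shows "(\<integral>\<^sup>+x. ennreal ((1 + x\<^sup>2) powr (- b)) \<partial>lborel) < \<infinity>"
proof -
  define g where "g x = (if x < 0 then 0 else ennreal (2 powr b * (1 + x) powr (- 2 * b)))" for x :: real
  have [measurable]: "g \<in> borel_measurable borel" unfolding g_def[abs_def] by measurable
  have "((\<lambda>x. 2 powr b * (1 + x) powr (1 - 2 * b) / (1 - 2 * b)) \<longlongrightarrow> 2 powr b * 0 / (1 - 2 * b)) at_top"
    using b by (intro tendsto_intros tendsto_neg_powr filterlim_tendsto_add_at_top[OF tendsto_const] filterlim_ident) auto
  then have "(\<integral>\<^sup>+x. ennreal (2 powr b * (1 + x) powr (- 2 * b)) * indicator {0 ..} x \<partial>lborel)
      = ennreal (0 - 2 powr b * (1 + 0) powr (1 - 2 * b) / (1 - 2 * b))"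
    using b by (intro nn_integral_FTC_atLeast) (auto intro!: derivative_eq_intros)
  moreover have "(\<integral>\<^sup>+x. g x \<partial>lborel) = (\<integral>\<^sup>+x. ennreal (2 powr b * (1 + x) powr (- 2 * b)) * indicator {0 ..} x \<partial>lborel)"
    by (intro nn_integral_cong) (auto simp: g_def split: split_indicator)
  ultimately have fin: "(\<integral>\<^sup>+x. g x \<partial>lborel) < \<infinity>" by simp
  have refl: "(\<integral>\<^sup>+x. g (- x) \<partial>lborel) = (\<integral>\<^sup>+x. g x \<partial>lborel)"
    using nn_integral_real_affine[of g "-1" 0] by simp
  have half: "(1 + x\<^sup>2) powr (- b) \<le> 2 powr b * (1 + x) powr (- 2 * b)" if "0 \<le> x" for x :: real
  proof -
    have "(1 + x)\<^sup>2 \<le> 2 * (1 + x\<^sup>2)" using sum_squares_bound[of 1 x] by (simp add: power2_sum)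
    then have "(2 * (1 + x\<^sup>2)) powr (- b) \<le> ((1 + x)\<^sup>2) powr (- b)"
      using b that by (intro powr_mono2') auto
    moreover have "((1 + x)\<^sup>2) powr (- b) = (1 + x) powr (- 2 * b)"
      using that by (simp add: powr_powr flip: powr_numeral)
    moreover have "(2 * (1 + x\<^sup>2)) powr (- b) = 2 powr (- b) * (1 + x\<^sup>2) powr (- b)"
      by (rule powr_mult)
    ultimately have "2 powr b * (2 powr (- b) * (1 + x\<^sup>2) powr (- b)) \<le> 2 powr b * (1 + x) powr (- 2 * b)"
      by (intro mult_left_mono) simp_all
    then show ?thesis by (simp add: mult.assoc[symmetric] flip: powr_add)
  qed
  have "(\<integral>\<^sup>+x. ennreal ((1 + x\<^sup>2) powr (- b)) \<partial>lborel) \<le> (\<integral>\<^sup>+x. g x + g (- x) \<partial>lborel)"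
  proof (intro nn_integral_mono)
    fix x :: real
    show "ennreal ((1 + x\<^sup>2) powr (- b)) \<le> g x + g (- x)"
    proof (cases "x < 0")
      case True
      then show ?thesis using ennreal_leI[OF half[of "- x"]] by (simp add: g_def)
    next
      case False
      then have "ennreal ((1 + x\<^sup>2) powr (- b)) \<le> g x" using ennreal_leI[OF half[of x]] by (simp add: g_def)
      then show ?thesis by (rule order_trans) simp
    qed
  qed
  also have "\<dots> = (\<integral>\<^sup>+x. g x \<partial>lborel) + (\<integral>\<^sup>+x. g x \<partial>lborel)"
    by (simp add: nn_integral_add refl)
  also have "\<dots> < \<infinity>" using fin by simp
  finally show ?thesis .
qed

lemma nn_integral_weight:
  assumes b: "b > 1 / 2"
  shows "(\<integral>\<^sup>+x. ennreal (weight b x) \<partial>(lborel :: (real ^ 'n) measure)) < \<infinity>"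
proof -
  have B: "(Basis :: (real ^ 'n) set) = range (\<lambda>i. axis i 1)" by (auto simp: Basis_vec_def)
  have inj: "inj (\<lambda>i::'n. axis i (1::real))" by (auto intro!: injI simp: axis_eq_axis)
  have "weight b x = (\<Prod>e\<in>Basis. (1 + (x \<bullet> e)\<^sup>2) powr (- b))" for x :: "real ^ 'n"
    unfolding weight_def B by (subst prod.reindex[OF inj]) (simp add: cart_eq_inner_axis)
  then have "(\<integral>\<^sup>+x. ennreal (weight b x) \<partial>(lborel :: (real ^ 'n) measure))
     = (\<integral>\<^sup>+x. (\<Prod>e\<in>Basis. ennreal ((1 + (x \<bullet> e)\<^sup>2) powr (- b))) \<partial>(lborel :: (real ^ 'n) measure))"
    by (simp add: prod_ennreal)
  also have "\<dots> = (\<Prod>e\<in>(Basis :: (real ^ 'n) set). \<integral>\<^sup>+x. ennreal ((1 + x\<^sup>2) powr (- b)) \<partial>lborel)"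
    by (rule nn_integral_lborel_prod) auto
  also have "\<dots> < \<infinity>"
    using nn_integral_one_plus_square_powr[OF b] by (simp add: power_less_top_ennreal)
  finally show ?thesis .
qed

text \<open>
  A power of a weight is again a weight, so every Lebesgue norm reduces to an integral of weights.
\<close>

lemma weight_Lp_le:
  assumes u: "0 \<le> u" and b: "u < 2 * b \<or> u = 0 \<and> b = 0"
  obtains c where "Lp_le u (weight b :: real ^ 'n \<Rightarrow> real) c"
proof (cases "u = 0")
  case True
  have "weight b x \<le> 1" for x :: "real ^ 'n"
    unfolding weight_def using b True
    by (intro prod_le_1) (auto simp: powr_minus_divide divide_le_eq_1 intro!: ge_one_powr_ge_zero)
  then have "Lp_le u (weight b :: real ^ 'n \<Rightarrow> real) 1"
    using True by (simp add: Lp_le_def weight_nonneg)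
  then show ?thesis by (rule that)
next
  case False
  with u have u: "u > 0" by simp
  let ?I = "\<integral>\<^sup>+x. ennreal (weight (b / u) x) \<partial>(lborel :: (real ^ 'n) measure)"
  have pw: "weight b x powr (1 / u) = weight (b / u) x" for x :: "real ^ 'n"
    unfolding weight_def by (simp add: prod_powr_distrib powr_powr)
  have "?I < \<infinity>" using u b by (intro nn_integral_weight) (auto simp: field_simps)
  then have "?I = ennreal (enn2real ?I)" by simp
  then have "Lp_le u (weight b :: real ^ 'n \<Rightarrow> real) (enn2real ?I powr u)"
    using u by (simp add: Lp_le_def weight_nonneg pw powr_powr)
  then show ?thesis by (rule that)
qed

text \<open>
  Each of the \<open>n\<close> factors \<open>1 + (x $ i)\<^sup>2\<close> is at most \<open>1 + |x|\<^sup>2\<close>.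
\<close>

lemma weight_ge:
  fixes x :: "real ^ 'n" and b :: real
  assumes b: "0 \<le> b"
  shows "(1 + (norm x)\<^sup>2) powr (- (b * CARD('n))) \<le> weight b x"
proof -
  have pos: "0 < 1 + (norm x)\<^sup>2" by (simp add: add_pos_nonneg)
  have "(1 + (norm x)\<^sup>2) powr (- (b * CARD('n))) = (\<Prod>i\<in>(UNIV :: 'n set). (1 + (norm x)\<^sup>2) powr (- b))"
    using pos by (simp add: powr_powr powr_realpow[symmetric])
  also have "\<dots> \<le> weight b x"
    unfolding weight_def
  proof (intro prod_mono conjI powr_mono2')
    fix i :: 'n
    have "(x $ i)\<^sup>2 \<le> (norm x)\<^sup>2" using component_le_norm_cart[of x i] by (rule abs_le_square_iff[THEN iffD1, OF order_trans]) simp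
    then show "1 + (x $ i)\<^sup>2 \<le> 1 + (norm x)\<^sup>2" by simp
  qed (use b in \<open>auto simp: add_pos_nonneg\<close>)
  finally show ?thesis .
qed

section \<open>The symbol at low and at high frequencies\<close>

text \<open>
  The inequality \<open>ln z \<le> z - 1\<close> at \<open>z = c * y / N\<close> says that \<open>N * ln y - c * y\<close> is bounded
  above.
\<close>

lemma powr_mult_exp_bounded:
  fixes N c :: real
  assumes N: "0 \<le> N" and c: "0 < c"
  obtains C where "C > 0" "\<And>y. 0 < y \<Longrightarrow> y powr N * exp (- c * y) \<le> C"
proof (cases "N = 0")
  case True
  show ?thesis by (rule that[of 1]) (use True c in auto)
next
  case False
  with N have N: "N > 0" by simp
  show ?thesis
  proof (rule that[of "exp (N * ln (N / c))"])
    fix y :: real assume y: "0 < y"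
    have "ln y = ln (c * y / N) + ln (N / c)" using y c N by (simp add: ln_mult ln_div)
    also have "ln (c * y / N) \<le> c * y / N - 1" using y c N by (intro ln_le_minus_one) auto
    finally have "N * ln y \<le> N * (c * y / N + ln (N / c))" using N by (intro mult_left_mono) auto
    also have "\<dots> = c * y + N * ln (N / c)" using N by (simp add: field_simps)
    finally show "y powr N * exp (- c * y) \<le> exp (N * ln (N / c))"
      using y by (simp add: powr_def flip: exp_add)
  qed simp
qed

text \<open>
  With \<open>s = |\<xi>|\<^sup>2\<close>, the denominator of \<open>eta \<xi> = s / (1 + s)\<^sup>2\<close> is at most \<open>4\<close> if \<open>s \<le> 1\<close>
  and at most \<open>4 * s\<^sup>2\<close> if \<open>s > 1\<close>.
\<close>

lemma eta_lower_bounds: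
  shows "norm \<xi> \<le> 1 \<Longrightarrow> (norm \<xi>)\<^sup>2 / 4 \<le> eta \<xi>"
    and "1 < norm \<xi> \<Longrightarrow> 1 / (4 * (norm \<xi>)\<^sup>2) \<le> eta \<xi>"
proof -
  define s where "s = (norm \<xi>)\<^sup>2"
  have s0: "0 \<le> s" by (simp add: s_def)
  { assume "norm \<xi> \<le> 1"
    then have "s \<le> 1" by (simp add: s_def power_le_one)
    then have "(1 + s)\<^sup>2 \<le> 2\<^sup>2" using s0 by (intro power_mono) auto
    then have "s / 4 \<le> s / (1 + s)\<^sup>2" using s0 by (intro divide_left_mono) (auto simp: add_pos_nonneg)
    then show "(norm \<xi>)\<^sup>2 / 4 \<le> eta \<xi>" by (simp add: eta_def s_def) }
  { assume "1 < norm \<xi>"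
    then have s1: "1 < s" by (simp add: s_def one_less_power)
    then have "(1 + s)\<^sup>2 \<le> (2 * s)\<^sup>2" by (intro power_mono) auto
    then have "1 / (4 * s) \<le> s / (1 + s)\<^sup>2" using s1 by (simp add: field_simps power2_eq_square)
    then show "1 / (4 * (norm \<xi>)\<^sup>2) \<le> eta \<xi>" by (simp add: eta_def s_def) }
qed

lemma borel_measurable_eta [measurable]: "eta \<in> borel_measurable borel"
  unfolding eta_def[abs_def] by measurable

text \<open>
  The two frequency regimes of \<open>|\<xi>|^k * exp (- eta \<xi> * t)\<close>, with \<open>d = k - j\<close>, after the powers
  \<open>|\<xi>|^j\<close> and \<open>|\<xi>|^(k+l)\<close> have been moved to the transform of \<open>\<phi>\<close>.
\<close>

definition low_multiplier :: "nat \<Rightarrow> real \<Rightarrow> real ^ 'n \<Rightarrow> real" where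
  "low_multiplier d t \<xi> = (if norm \<xi> \<le> 1 then norm \<xi> ^ d * exp (- eta \<xi> * t) else 0)"

definition high_multiplier :: "nat \<Rightarrow> real \<Rightarrow> real ^ 'n \<Rightarrow> real" where
  "high_multiplier l t \<xi> = (if norm \<xi> \<le> 1 then 0 else exp (- eta \<xi> * t) / norm \<xi> ^ l)"

lemma borel_measurable_multipliers [measurable]:
  "low_multiplier d t \<in> borel_measurable borel" "high_multiplier l t \<in> borel_measurable borel"
  unfolding low_multiplier_def[abs_def] high_multiplier_def[abs_def] by measurable

text \<open>
  The common last step for both multipliers, with \<open>T = 1 + t\<close> and \<open>\<sigma> = 1/2\<close> or \<open>\<sigma> = -1/2\<close>.
\<close>

lemma rescaled_weight_Lp_le:
  fixes m :: "real ^ 'n \<Rightarrow> real" and u b :: real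
  assumes u: "0 \<le> u" and w: "Lp_le u (weight b :: real ^ 'n \<Rightarrow> real) c" and T: "0 < T" and K: "0 \<le> K"
    and [measurable]: "m \<in> borel_measurable borel"
    and le: "\<And>\<xi>. \<bar>m \<xi>\<bar> \<le> K * T powr a * weight b (T powr \<sigma> *\<^sub>R \<xi>)"
  shows "Lp_le u m (K * c * T powr (a - \<sigma> * (CARD('n) * u)))"
proof -
  have "Lp_le u (\<lambda>\<xi>::real ^ 'n. weight b (T powr \<sigma> *\<^sub>R \<xi>)) (\<bar>T powr \<sigma>\<bar> powr (- real CARD('n) * u) * c)"
    using T u by (intro Lp_le_scaleR w) auto
  then have *: "Lp_le u (\<lambda>\<xi>::real ^ 'n. (K * T powr a) * norm (weight b (T powr \<sigma> *\<^sub>R \<xi>))) 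
      (\<bar>K * T powr a\<bar> * (\<bar>T powr \<sigma>\<bar> powr (- real CARD('n) * u) * c))"
    by (rule Lp_le_cmult) (rule u)
  show ?thesis
  proof (rule Lp_le_mono[OF *])
    show "\<bar>K * T powr a\<bar> * (\<bar>T powr \<sigma>\<bar> powr (- real CARD('n) * u) * c) \<le> K * c * T powr (a - \<sigma> * (CARD('n) * u))"
      using K T by (simp add: powr_powr powr_diff powr_minus_divide abs_mult mult_ac)
  qed (use le K u in \<open>auto simp: weight_nonneg abs_mult\<close>)
qed

text \<open>
  With \<open>T = 1 + t\<close> and \<open>\<zeta> = T\<^bsup>1/2\<^esup> \<xi>\<close>, the multiplier is at most a constant times
  \<open>T\<^bsup>- d/2\<^esup> |\<zeta>|^d exp (- |\<zeta>|\<^sup>2 / 4)\<close>, and the Gaussian beats any weight. Replacing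
  \<open>t\<close> by \<open>1 + t\<close> costs a constant factor since \<open>|\<xi>| \<le> 1\<close>; it makes the estimate uniform down to
  \<open>t = 0\<close>.
\<close>

lemma low_multiplier_Lp_le:
  fixes u :: real
  assumes u: "0 \<le> u" "u \<le> 1"
  obtains K where "0 \<le> K" "\<And>t. 0 \<le> t \<Longrightarrow>
    Lp_le u (low_multiplier d t :: real ^ 'n \<Rightarrow> real) (K * (1 + t) powr (- (real CARD('n) * u / 2) - real d / 2))"
proof -
  let ?n = "real CARD('n)"
  obtain c where c: "Lp_le u (weight 1 :: real ^ 'n \<Rightarrow> real) c"
    using weight_Lp_le[of u 1] u by auto
  obtain C where C: "C > 0" "\<And>y. 0 < y \<Longrightarrow> y powr (real d / 2 + ?n) * exp (- (1 / 4) * y) \<le> C"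
    using powr_mult_exp_bounded[of "real d / 2 + ?n" "1 / 4"] by auto
  show thesis
  proof (rule that[of "exp (1 / 2) * C * c"])
    show "0 \<le> exp (1 / 2) * C * c" using C Lp_le_nonneg[OF c] by simp
    fix t :: real assume t: "0 \<le> t"
    let ?T = "1 + t"
    have "\<bar>low_multiplier d t \<xi>\<bar> \<le> exp (1 / 2) * C * ?T powr (- real d / 2) * weight 1 (?T powr (1 / 2) *\<^sub>R \<xi>)" for \<xi> :: "real ^ 'n"
    proof (cases "norm \<xi> \<le> 1")
      case False
      then show ?thesis using C by (simp add: low_multiplier_def weight_nonneg)
    next
      case True
      define \<zeta> where "\<zeta> = ?T powr (1 / 2) *\<^sub>R \<xi>"
      define y where "y = 1 + (norm \<zeta>)\<^sup>2"
      have y: "y \<ge> 1" by (simp add: y_def)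
      have n\<zeta>: "norm \<zeta> = ?T powr (1 / 2) * norm \<xi>" by (simp add: \<zeta>_def)
      have sq: "(norm \<zeta>)\<^sup>2 = ?T * (norm \<xi>)\<^sup>2" 
        using t by (simp add: n\<zeta> power_mult_distrib powr_half_sqrt)
      have "- eta \<xi> * t \<le> - ((norm \<xi>)\<^sup>2 / 4 * t)"
        using mult_right_mono[OF eta_lower_bounds(1)[OF True] t] by simp
      also have "\<dots> = (norm \<xi>)\<^sup>2 / 4 - (y - 1) / 4" by (simp add: y_def sq algebra_simps)
      also have "\<dots> \<le> 1 / 2 - y / 4" using True by (simp add: power_le_one field_simps)
      finally have e: "exp (- eta \<xi> * t) \<le> exp (1 / 2) * exp (- (1 / 4) * y)" by (simp flip: exp_add)
      have "norm \<xi> ^ d = ?T powr (- real d / 2) * norm \<zeta> ^ d"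
        using t by (simp add: n\<zeta> power_mult_distrib powr_powr powr_minus_divide flip: powr_realpow)
      moreover have "norm \<zeta> ^ d \<le> y powr (real d / 2)"
      proof -
        have "norm \<zeta> \<le> y powr (1 / 2)" using y by (simp add: powr_half_sqrt y_def real_le_rsqrt)
        then have "norm \<zeta> ^ d \<le> (y powr (1 / 2)) ^ d" by (intro power_mono) auto
        then show ?thesis using y by (simp add: powr_powr flip: powr_realpow)
      qed
      ultimately have "norm \<xi> ^ d * exp (- eta \<xi> * t) 
          \<le> (?T powr (- real d / 2) * y powr (real d / 2)) * (exp (1 / 2) * exp (- (1 / 4) * y))"
        using e by (intro mult_mono) (auto intro: mult_left_mono)
      also have "y powr (real d / 2) = y powr (real d / 2 + ?n) * y powr (- ?n)"
        by (simp flip: powr_add)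
      also have "(?T powr (- real d / 2) * (y powr (real d / 2 + ?n) * y powr (- ?n))) * (exp (1 / 2) * exp (- (1 / 4) * y))
         = exp (1 / 2) * (y powr (real d / 2 + ?n) * exp (- (1 / 4) * y)) * ?T powr (- real d / 2) * y powr (- ?n)"
        by (simp only: mult_ac)
      also have "\<dots> \<le> exp (1 / 2) * C * ?T powr (- real d / 2) * weight 1 \<zeta>"
        using C(1) C(2)[of y] y weight_ge[of 1 \<zeta>] by (intro mult_mono) (simp_all add: y_def[symmetric])
      finally show ?thesis using True by (simp add: low_multiplier_def \<zeta>_def abs_mult)
    qed
    then have "Lp_le u (low_multiplier d t :: real ^ 'n \<Rightarrow> real) (exp (1 / 2) * C * c * ?T powr (- real d / 2 - 1 / 2 * (?n * u)))"
      using t C by (intro rescaled_weight_Lp_le[OF u(1) c]) auto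
    moreover have eq: "- real d / 2 - 1 / 2 * (?n * u) = - (?n * u / 2) - real d / 2" by simp
    ultimately show "Lp_le u (low_multiplier d t :: real ^ 'n \<Rightarrow> real) (exp (1 / 2) * C * c * ?T powr (- (?n * u / 2) - real d / 2))"
      by (simp only: eq)
  qed
qed

text \<open>
  With \<open>T = 1 + t\<close> and \<open>\<zeta> = T\<^bsup>-1/2\<^esup> \<xi>\<close>, the multiplier is at most a constant times
  \<open>T\<^bsup>- l/2\<^esup> |\<zeta>|^(-l) exp (- 1 / (4 |\<zeta>|\<^sup>2))\<close>. The exponential removes the singularity
  at \<open>\<zeta> = 0\<close>, so this is controlled by \<open>(1 + |\<zeta>|\<^sup>2) powr (- l/2)\<close>, which has a finite norm
  exactly when \<open>n * u < l\<close> (or \<open>u = 0\<close>). The exponent \<open>b = l / (2 * n)\<close> of the weight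
  spreads this radial decay over the coordinates.
\<close>

lemma high_multiplier_Lp_le:
  fixes u :: real
  assumes u: "0 \<le> u" and l: "real CARD('n) * u < real l \<or> u = 0"
  obtains K where "0 \<le> K" "\<And>t. 0 \<le> t \<Longrightarrow>
    Lp_le u (high_multiplier l t :: real ^ 'n \<Rightarrow> real) (K * (1 + t) powr (- (real l / 2) + real CARD('n) * u / 2))"
proof -
  let ?n = "real CARD('n)"
  define b where "b = real l / (2 * ?n)"
  have b0: "0 \<le> b" by (simp add: b_def)
  have bn: "b * ?n = real l / 2" by (simp add: b_def)
  obtain c where c: "Lp_le u (weight b :: real ^ 'n \<Rightarrow> real) c"
  proof (rule weight_Lp_le[OF u])
    show "u < 2 * b \<or> u = 0 \<and> b = 0"
      using l b0 by (cases "u = 0") (auto simp: b_def field_simps)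
  qed
  obtain C where C: "C > 0" "\<And>y. 0 < y \<Longrightarrow> y powr (real l / 2) * exp (- (1 / 4) * y) \<le> C"
    using powr_mult_exp_bounded[of "real l / 2" "1 / 4"] by auto
  show thesis
  proof (rule that[of "exp (1 / 2) * C * c"])
    show "0 \<le> exp (1 / 2) * C * c" using C Lp_le_nonneg[OF c] by simp
    fix t :: real assume t: "0 \<le> t"
    let ?T = "1 + t"
    have "\<bar>high_multiplier l t \<xi>\<bar> \<le> exp (1 / 2) * C * ?T powr (- real l / 2) * weight b (?T powr (- 1 / 2) *\<^sub>R \<xi>)" for \<xi> :: "real ^ 'n"
    proof (cases "norm \<xi> \<le> 1")
      case True
      then show ?thesis using C by (simp add: high_multiplier_def weight_nonneg)
    next
      case False
      define \<zeta> where "\<zeta> = ?T powr (- 1 / 2) *\<^sub>R \<xi>"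
      define s where "s = (norm \<zeta>)\<^sup>2"
      define z where "z = 1 + 1 / s"
      have n\<zeta>: "norm \<zeta> = ?T powr (- 1 / 2) * norm \<xi>" by (simp add: \<zeta>_def)
      have sq: "s = (norm \<xi>)\<^sup>2 / ?T" 
        using t by (simp add: s_def n\<zeta> power_mult_distrib powr_minus_divide powr_half_sqrt power_divide)
      have "0 < norm \<xi>" using False by linarith
      then have s: "0 < s" using t by (simp add: sq)
      then have z: "1 \<le> z" by (simp add: z_def)
      have "- eta \<xi> * t \<le> - (1 / (4 * (norm \<xi>)\<^sup>2) * t)"
        using mult_right_mono[OF eta_lower_bounds(2)[of \<xi>] t] False by simp
      also have "\<dots> = 1 / (4 * (norm \<xi>)\<^sup>2) - (z - 1) / 4"
        by (simp add: z_def sq add_divide_distrib)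
      also have "\<dots> \<le> 1 / 2 - z / 4"
      proof -
        have "1 \<le> (norm \<xi>)\<^sup>2" using False by (intro one_le_power) auto
        then have "1 / (4 * (norm \<xi>)\<^sup>2) \<le> 1 / 4" by (intro divide_left_mono) auto
        then show ?thesis by (simp only: diff_divide_distrib)
      qed
      finally have e: "exp (- eta \<xi> * t) \<le> exp (1 / 2) * exp (- (1 / 4) * z)" by (simp flip: exp_add)
      have "norm \<xi> = ?T powr (1 / 2) * s powr (1 / 2)"
        using t False by (simp add: sq powr_divide powr_half_sqrt)
      then have "norm \<xi> ^ l = ?T powr (real l / 2) * s powr (real l / 2)"
        using t s by (simp add: power_mult_distrib powr_powr flip: powr_realpow)
      then have "exp (- eta \<xi> * t) / norm \<xi> ^ l = exp (- eta \<xi> * t) * (?T powr (- real l / 2) * s powr (- (real l / 2)))"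
        by (simp add: powr_minus_divide)
      also have "\<dots> \<le> (exp (1 / 2) * exp (- (1 / 4) * z)) * (?T powr (- real l / 2) * s powr (- (real l / 2)))"
        using e by (intro mult_right_mono) auto
      also have "s powr (- (real l / 2)) = z powr (real l / 2) * (1 + s) powr (- (real l / 2))"
      proof -
        have "1 + s = z * s" using s by (simp add: z_def field_simps)
        then show ?thesis using s z by (simp add: powr_mult powr_minus_divide)
      qed
      also have "(exp (1 / 2) * exp (- (1 / 4) * z)) * (?T powr (- real l / 2) * (z powr (real l / 2) * (1 + s) powr (- (real l / 2))))
         = exp (1 / 2) * (z powr (real l / 2) * exp (- (1 / 4) * z)) * ?T powr (- real l / 2) * (1 + s) powr (- (real l / 2))"
        by (simp only: mult_ac)
      also have "\<dots> \<le> exp (1 / 2) * C * ?T powr (- real l / 2) * weight b \<zeta>"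
        using C(1) C(2)[of z] z weight_ge[OF b0, of \<zeta>] by (intro mult_mono) (simp_all add: s_def[symmetric] bn)
      finally show ?thesis using False by (simp add: high_multiplier_def \<zeta>_def)
    qed
    then have "Lp_le u (high_multiplier l t :: real ^ 'n \<Rightarrow> real) (exp (1 / 2) * C * c * ?T powr (- real l / 2 - (- 1 / 2) * (?n * u)))"
      using t C by (intro rescaled_weight_Lp_le[OF u c]) auto
    moreover have eq: "- real l / 2 - (- 1 / 2) * (?n * u) = - (real l / 2) + ?n * u / 2" by simp
    ultimately show "Lp_le u (high_multiplier l t :: real ^ 'n \<Rightarrow> real) (exp (1 / 2) * C * c * ?T powr (- (real l / 2) + ?n * u / 2))"
      by (simp only: eq)
  qed
qed

section \<open>The Fourier transform of integrable functions\<close>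

abbreviation fourier_kernel :: "real ^ 'n \<Rightarrow> real ^ 'n \<Rightarrow> complex" where
  "fourier_kernel x \<xi> \<equiv> exp (- 2 * of_real pi * \<i> * of_real (x \<bullet> \<xi>))"

lemma norm_integral_le_nn_integral:
  fixes f :: "'a \<Rightarrow> complex"
  shows "ennreal (norm (integral\<^sup>L M f)) \<le> (\<integral>\<^sup>+x. ennreal (norm (f x)) \<partial>M)"
  by (cases "integrable M f") (auto simp: integral_norm_bound_ennreal not_integrable_integral_eq)

lemma borel_measurable_cnj [measurable]: "cnj \<in> borel_measurable borel"
  by (intro borel_measurable_continuous_onI continuous_intros)

lemma borel_measurable_fourier:
  assumes [measurable]: "f \<in> borel_measurable borel"
  shows "fourier f \<in> borel_measurable borel"
proof -
  have "(\<lambda>\<xi>. \<integral>x. f x * fourier_kernel x \<xi> \<partial>lborel) \<in> borel_measurable borel"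
    by (rule lborel.borel_measurable_lebesgue_integral) measurable
  then show ?thesis by (simp add: fourier_def[abs_def])
qed

lemma norm_fourier_le: "ennreal (norm (fourier f \<xi>)) \<le> (\<integral>\<^sup>+x. ennreal (norm (f x)) \<partial>lborel)"
  using norm_integral_le_nn_integral[of lborel "\<lambda>x. f x * fourier_kernel x \<xi>"]
  by (simp add: fourier_def norm_mult)

lemma integrable_mult_bounded:
  fixes f g :: "real ^ 'n \<Rightarrow> complex"
  assumes f: "integrable lborel f" and [measurable]: "g \<in> borel_measurable borel" and "\<And>x. norm (g x) \<le> 1"
  shows "integrable lborel (\<lambda>x. f x * g x)"
proof (rule Bochner_Integration.integrable_bound[OF f])
  have [measurable]: "f \<in> borel_measurable borel" using borel_measurable_integrable[OF f] by simp
  show "(\<lambda>x. f x * g x) \<in> borel_measurable lborel" by measurable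
  show "AE x in lborel. norm (f x * g x) \<le> norm (f x)"
    using assms(3) by (intro AE_I2) (simp add: norm_mult mult_left_le)
qed

lemma fourier_kernel_integrable:
  assumes "integrable lborel f"
  shows "integrable lborel (\<lambda>x. f x * fourier_kernel x \<xi>)"
  using assms by (rule integrable_mult_bounded) auto

text \<open>
  The kernel is unimodular, so the integrand is integrable only if \<open>f\<close> is; otherwise the Bochner
  integral takes its default value \<open>0\<close>. Estimates of \<open>fourier f\<close> for such \<open>f\<close>
  are therefore trivial, and integrability of \<open>f\<close> can always be assumed.
\<close>

lemma fourier_not_integrable:
  assumes "\<not> integrable lborel f"
  shows "fourier f = (\<lambda>\<xi>. 0)"
proof
  fix \<xi>
  have "\<not> integrable lborel (\<lambda>x. f x * fourier_kernel x \<xi>)"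
  proof
    assume "integrable lborel (\<lambda>x. f x * fourier_kernel x \<xi>)"
    then have "integrable lborel (\<lambda>x. (f x * fourier_kernel x \<xi>) * fourier_kernel x (- \<xi>))"
      by (rule integrable_mult_bounded) auto
    then have "integrable lborel f" by (simp add: mult.assoc flip: exp_add)
    with assms show False by simp
  qed
  then show "fourier f \<xi> = 0" by (simp add: fourier_def not_integrable_integral_eq)
qed

lemma fourier_diff:
  assumes "integrable lborel f" "integrable lborel g"
  shows "fourier (\<lambda>x. f x - g x) \<xi> = fourier f \<xi> - fourier g \<xi>"
  unfolding fourier_def
  using assms[THEN fourier_kernel_integrable, of \<xi>]
  by (simp only: ring_distribs Bochner_Integration.integral_diff)

lemma fourier_add:
  assumes "integrable lborel f" "integrable lborel g"
  shows "fourier (\<lambda>x. f x + g x) \<xi> = fourier f \<xi> + fourier g \<xi>"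
  unfolding fourier_def
  using assms[THEN fourier_kernel_integrable, of \<xi>]
  by (simp only: ring_distribs Bochner_Integration.integral_add)

lemma fourier_cmult: "fourier (\<lambda>x. c * f x) \<xi> = c * fourier f \<xi>"
  unfolding fourier_def by (simp add: mult.assoc)

lemma inv_fourier_eq: "inv_fourier g x = fourier g (- x)"
  unfolding fourier_def inv_fourier_def by (simp add: inner_commute)

text \<open>
  Fubini's theorem in the form needed for the multiplication formula: \<open>f x * h y\<close> is integrable on
  the product space, and a bounded kernel does not change that.
\<close>

lemma integral_swap_bounded_kernel:
  fixes f h :: "real ^ 'n \<Rightarrow> complex"
  assumes f: "integrable lborel f" and h: "integrable lborel h"
    and [measurable]: "(\<lambda>(x, y). k x y) \<in> borel_measurable (borel \<Otimes>\<^sub>M borel)"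
    and k: "\<And>x y. norm (k x y) \<le> 1"
  shows "(\<integral>y. (\<integral>x. f x * h y * k x y \<partial>lborel) \<partial>lborel) = (\<integral>x. (\<integral>y. f x * h y * k x y \<partial>lborel) \<partial>lborel)"
proof -
  have [measurable]: "f \<in> borel_measurable borel" "h \<in> borel_measurable borel"
    using borel_measurable_integrable[OF f] borel_measurable_integrable[OF h] by auto
  have "integrable (lborel \<Otimes>\<^sub>M lborel) (\<lambda>(x, y). f x * h y * k x y)"
    unfolding integrable_iff_bounded
  proof
    show "(\<lambda>(x, y). f x * h y * k x y) \<in> borel_measurable (lborel \<Otimes>\<^sub>M lborel)" by measurable
    have "(\<integral>\<^sup>+p. ennreal (norm (case p of (x, y) \<Rightarrow> f x * h y * k x y)) \<partial>(lborel \<Otimes>\<^sub>M lborel))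
       \<le> (\<integral>\<^sup>+p. (case p of (x, y) \<Rightarrow> ennreal (norm (f x)) * ennreal (norm (h y))) \<partial>(lborel \<Otimes>\<^sub>M lborel))"
      using k by (intro nn_integral_mono)
        (auto simp: norm_mult split: prod.split simp flip: ennreal_mult intro!: ennreal_leI mult_left_le)
    also have "\<dots> = (\<integral>\<^sup>+x. \<integral>\<^sup>+y. ennreal (norm (f x)) * ennreal (norm (h y)) \<partial>lborel \<partial>lborel)"
      by (subst lborel.nn_integral_fst[symmetric]) auto
    also have "\<dots> = (\<integral>\<^sup>+x. ennreal (norm (f x)) \<partial>lborel) * (\<integral>\<^sup>+y. ennreal (norm (h y)) \<partial>lborel)"
      by (simp add: nn_integral_cmult nn_integral_multc)
    also have "\<dots> < \<infinity>"
      using f h by (simp add: integrable_iff_bounded ennreal_mult_less_top)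
    finally show "(\<integral>\<^sup>+p. ennreal (norm (case p of (x, y) \<Rightarrow> f x * h y * k x y)) \<partial>(lborel \<Otimes>\<^sub>M lborel)) < \<infinity>" .
  qed
  from lborel_pair.Fubini_integral[OF this] show ?thesis by simp
qed

section \<open>Plancherel's inequality by Gaussian regularization\<close>

text \<open>
  The product form of \<open>exp (- |x|\<^sup>2 / 2)\<close>, to which the one-dimensional facts about the
  normal distribution apply factor by factor.
\<close>

definition gauss :: "real ^ 'n \<Rightarrow> real" where
  "gauss x = (\<Prod>b\<in>Basis. exp (- (x \<bullet> b)\<^sup>2 / 2))"

lemma borel_measurable_gauss [measurable]: "gauss \<in> borel_measurable borel"
  unfolding gauss_def[abs_def] by measurable

lemma gauss_nonneg: "0 \<le> gauss x"
  unfolding gauss_def by (intro prod_nonneg) simp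

lemma gauss_normal_density:
  "gauss (x :: real ^ 'n) = sqrt (2 * pi) ^ CARD('n) * (\<Prod>b\<in>Basis. std_normal_density (x \<bullet> b))"
  by (simp add: gauss_def std_normal_density_def prod_dividef)

lemma nn_integral_gauss:
  "(\<integral>\<^sup>+x. ennreal (gauss x) \<partial>(lborel :: (real ^ 'n) measure)) = ennreal (sqrt (2 * pi) ^ CARD('n))"
proof -
  have "(\<integral>\<^sup>+x. ennreal (gauss x) \<partial>(lborel :: (real ^ 'n) measure))
      = (\<integral>\<^sup>+x. ennreal (sqrt (2 * pi) ^ CARD('n)) * (\<Prod>b\<in>Basis. ennreal (std_normal_density (x \<bullet> b))) \<partial>(lborel :: (real ^ 'n) measure))"
    by (simp add: gauss_normal_density ennreal_mult prod_nonneg prod_ennreal)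
  also have "\<dots> = ennreal (sqrt (2 * pi) ^ CARD('n)) * (\<Prod>b\<in>(Basis :: (real ^ 'n) set). \<integral>\<^sup>+x. ennreal (std_normal_density x) \<partial>lborel)"
    by (subst nn_integral_cmult, measurable) (subst nn_integral_lborel_prod, auto)
  also have "(\<integral>\<^sup>+x. ennreal (std_normal_density x) \<partial>lborel) = 1"
    by (subst nn_integral_eq_integral) auto
  finally show ?thesis by simp
qed

text \<open>
  The Gaussian is its own Fourier transform: the integral factorizes over the coordinates, and each
  factor is the characteristic function of the standard normal distribution.
\<close>

lemma integral_gauss_iexp:
  fixes z :: "real ^ 'n"
  shows "(\<integral>x. of_real (gauss x) * iexp (x \<bullet> z) \<partial>lborel) = complex_of_real (sqrt (2 * pi) ^ CARD('n) * gauss z)"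
proof -
  interpret product_sigma_finite "\<lambda>_::real ^ 'n. lborel :: real measure" ..
  have int: "integrable lborel (\<lambda>x. of_real (std_normal_density x) * iexp (t * x))" for t
  proof (rule Bochner_Integration.integrable_bound)
    show "integrable lborel std_normal_density" by simp
  qed (auto simp: norm_mult)
  have one: "(\<integral>x. of_real (std_normal_density x) * iexp (t * x) \<partial>lborel) = complex_of_real (exp (- t\<^sup>2 / 2))" for t
  proof -
    have "(\<integral>x. std_normal_density x *\<^sub>R iexp (t * x) \<partial>lborel) = char std_normal_distribution t"
      unfolding char_def by (subst integral_density) auto
    then show ?thesis by (simp add: char_std_normal_distribution scaleR_conv_of_real)
  qed
  have "(\<integral>x. of_real (gauss x) * iexp (x \<bullet> z) \<partial>lborel)
     = (\<integral>x. of_real (sqrt (2 * pi) ^ CARD('n)) * (\<Prod>b\<in>Basis. of_real (std_normal_density (x \<bullet> b)) * iexp ((z \<bullet> b) * (x \<bullet> b))) \<partial>lborel)"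
  proof (rule Bochner_Integration.integral_cong[OF refl])
    fix x :: "real ^ 'n"
    have "iexp (x \<bullet> z) = (\<Prod>b\<in>Basis. iexp ((z \<bullet> b) * (x \<bullet> b)))"
      by (subst exp_sum[symmetric]) (auto simp: sum_distrib_left euclidean_inner[of x z] mult.commute)
    then show "of_real (gauss x) * iexp (x \<bullet> z) = of_real (sqrt (2 * pi) ^ CARD('n)) * (\<Prod>b\<in>Basis. of_real (std_normal_density (x \<bullet> b)) * iexp ((z \<bullet> b) * (x \<bullet> b)))"
      by (simp add: gauss_normal_density prod.distrib of_real_prod)
  qed
  also have "\<dots> = of_real (sqrt (2 * pi) ^ CARD('n)) * (\<integral>x. (\<Prod>b\<in>Basis. of_real (std_normal_density (x \<bullet> b)) * iexp ((z \<bullet> b) * (x \<bullet> b))) \<partial>(lborel :: (real ^ 'n) measure))"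
    by simp
  also have "(\<integral>x. (\<Prod>b\<in>Basis. of_real (std_normal_density (x \<bullet> b)) * iexp ((z \<bullet> b) * (x \<bullet> b))) \<partial>(lborel :: (real ^ 'n) measure))
     = (\<integral>x. (\<Prod>b\<in>Basis. of_real (std_normal_density (x b)) * iexp ((z \<bullet> b) * x b)) \<partial>(\<Pi>\<^sub>M b\<in>(Basis :: (real ^ 'n) set). lborel))"
    by (subst lborel_eq, subst integral_distr) auto
  also have "\<dots> = (\<Prod>b\<in>(Basis :: (real ^ 'n) set). \<integral>x. of_real (std_normal_density x) * iexp ((z \<bullet> b) * x) \<partial>lborel)"
    by (rule product_integral_prod) (simp, rule int)
  also have "\<dots> = of_real (gauss z)"
    unfolding one gauss_def of_real_prod ..
  finally show ?thesis by simp
qed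

lemma integral_lborel_scaleR:
  fixes f :: "real ^ 'n \<Rightarrow> complex"
  assumes [measurable]: "f \<in> borel_measurable borel" and c: "c \<noteq> 0"
  shows "(\<integral>x. f (c *\<^sub>R x) \<partial>lborel) = of_real (1 / \<bar>c\<bar> ^ CARD('n)) * (\<integral>x. f x \<partial>lborel)"
proof -
  have "(\<integral>x. f x \<partial>lborel) = (\<bar>c\<bar> ^ CARD('n)) *\<^sub>R (\<integral>x. f (c *\<^sub>R x) \<partial>lborel)"
    using c by (subst lborel_affine[of c 0]) (auto simp: integral_density integral_distr)
  then show ?thesis using c by (simp add: scaleR_conv_of_real)
qed

text \<open>
  The transform of a wide Gaussian is a narrow normal density, by a dilation. Schur's test needs it
  as a nonnegative kernel of total mass one.
\<close>

lemma fourier_gauss: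
  fixes \<epsilon> :: real
  assumes \<epsilon>: "\<epsilon> > 0"
  obtains G :: "real ^ 'n \<Rightarrow> real" where "G \<in> borel_measurable borel" "\<And>z. 0 \<le> G z"
    "(\<integral>\<^sup>+z. ennreal (G z) \<partial>lborel) = 1"
    "\<And>z. fourier (\<lambda>\<xi>. of_real (gauss (\<epsilon> *\<^sub>R \<xi>))) z = of_real (G z)"
proof
  define c where "c = 2 * pi / \<epsilon>"
  define G :: "real ^ 'n \<Rightarrow> real" where "G z = (sqrt (2 * pi) / \<epsilon>) ^ CARD('n) * gauss (c *\<^sub>R z)" for z
  have c: "c > 0" using \<epsilon> by (simp add: c_def)
  show "G \<in> borel_measurable borel" unfolding G_def[abs_def] by measurable
  show "0 \<le> G z" for z using \<epsilon> by (simp add: G_def gauss_nonneg)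
  have "(\<integral>\<^sup>+z. ennreal (G z) \<partial>lborel) = ennreal ((sqrt (2 * pi) / \<epsilon>) ^ CARD('n)) * (\<integral>\<^sup>+z. ennreal (gauss (c *\<^sub>R z)) \<partial>(lborel :: (real ^ 'n) measure))"
    using \<epsilon> unfolding G_def by (simp add: ennreal_mult gauss_nonneg nn_integral_cmult)
  also have "(\<integral>\<^sup>+z. ennreal (gauss (c *\<^sub>R z)) \<partial>(lborel :: (real ^ 'n) measure)) = ennreal (1 / \<bar>c\<bar> ^ CARD('n)) * ennreal (sqrt (2 * pi) ^ CARD('n))"
    using c by (subst nn_integral_lborel_scaleR[where f="\<lambda>x. ennreal (gauss x)"]) (auto simp: nn_integral_gauss)
  also have "ennreal ((sqrt (2 * pi) / \<epsilon>) ^ CARD('n)) * \<dots> = ennreal ((sqrt (2 * pi) / \<epsilon> * (1 / c) * sqrt (2 * pi)) ^ CARD('n))"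
    using \<epsilon> c by (subst ennreal_mult[symmetric], simp, simp)+
      (simp only: power_mult_distrib power_one_over abs_of_pos mult.assoc)
  also have "sqrt (2 * pi) / \<epsilon> * (1 / c) * sqrt (2 * pi) = 1"
    using \<epsilon> by (simp add: c_def field_simps)
  finally show "(\<integral>\<^sup>+z. ennreal (G z) \<partial>lborel) = 1" by simp
  fix z :: "real ^ 'n"
  have "fourier (\<lambda>\<xi>. of_real (gauss (\<epsilon> *\<^sub>R \<xi>))) z
    = (\<integral>\<xi>. of_real (gauss (\<epsilon> *\<^sub>R \<xi>)) * iexp ((\<epsilon> *\<^sub>R \<xi>) \<bullet> ((- c) *\<^sub>R z)) \<partial>lborel)"
    unfolding fourier_def using \<epsilon> by (simp add: c_def mult_ac)
  also have "\<dots> = of_real (1 / \<bar>\<epsilon>\<bar> ^ CARD('n)) * (\<integral>\<xi>. of_real (gauss \<xi>) * iexp (\<xi> \<bullet> ((- c) *\<^sub>R z)) \<partial>lborel)"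
    using \<epsilon> by (intro integral_lborel_scaleR[where f="\<lambda>\<xi>. of_real (gauss \<xi>) * iexp (\<xi> \<bullet> ((- c) *\<^sub>R z))"]) auto
  also have "\<dots> = of_real (1 / \<bar>\<epsilon>\<bar> ^ CARD('n) * (sqrt (2 * pi) ^ CARD('n) * gauss ((- c) *\<^sub>R z)))"
    by (simp only: integral_gauss_iexp of_real_mult)
  also have "gauss ((- c) *\<^sub>R z) = gauss (c *\<^sub>R z)"
    by (simp add: gauss_def)
  finally show "fourier (\<lambda>\<xi>. of_real (gauss (\<epsilon> *\<^sub>R \<xi>))) z = of_real (G z)"
    using \<epsilon> by (simp add: G_def power_divide)
qed

lemma nn_integral_lborel_translate:
  fixes f :: "real ^ 'n \<Rightarrow> ennreal"
  assumes [measurable]: "f \<in> borel_measurable borel"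
  shows "(\<integral>\<^sup>+x. f (x - a) \<partial>lborel) = (\<integral>\<^sup>+x. f x \<partial>lborel)"
    and "(\<integral>\<^sup>+x. f (a - x) \<partial>lborel) = (\<integral>\<^sup>+x. f x \<partial>lborel)"
proof -
  show "(\<integral>\<^sup>+x. f (x - a) \<partial>lborel) = (\<integral>\<^sup>+x. f x \<partial>lborel)"
    by (subst (2) lborel_affine[of 1 "- a"]) (auto simp: nn_integral_density nn_integral_distr)
  show "(\<integral>\<^sup>+x. f (a - x) \<partial>lborel) = (\<integral>\<^sup>+x. f x \<partial>lborel)"
    by (subst (2) lborel_affine[of "- 1" a]) (auto simp: nn_integral_density nn_integral_distr)
qed

text \<open>
  By \<open>2 * a * b \<le> a\<^sup>2 + b\<^sup>2\<close> the form is bounded by two copies of the right-hand side, each with one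
  variable integrated out against \<open>G\<close>, which has total mass one.
\<close>

lemma Schur_test_convolution:
  fixes f :: "real ^ 'n \<Rightarrow> complex" and G :: "real ^ 'n \<Rightarrow> real"
  assumes [measurable]: "f \<in> borel_measurable borel" "G \<in> borel_measurable borel"
    and G0: "\<And>z. 0 \<le> G z" and G1: "(\<integral>\<^sup>+z. ennreal (G z) \<partial>lborel) = 1"
  shows "(\<integral>\<^sup>+x. \<integral>\<^sup>+y. ennreal (norm (f x) * norm (f y) * G (x - y)) \<partial>lborel \<partial>lborel)
       \<le> (\<integral>\<^sup>+x. ennreal ((norm (f x))\<^sup>2) \<partial>lborel)" (is "?L \<le> ?A")
proof -
  have Gy: "(\<integral>\<^sup>+y. ennreal (G (x - y)) \<partial>lborel) = 1" for x
    using nn_integral_lborel_translate(2)[of "\<lambda>z. ennreal (G z)" x] G1 by simp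
  have Gx: "(\<integral>\<^sup>+x. ennreal (G (x - y)) \<partial>lborel) = 1" for y
    using nn_integral_lborel_translate(1)[of "\<lambda>z. ennreal (G z)" y] G1 by simp
  have "2 * ?L = (\<integral>\<^sup>+x. \<integral>\<^sup>+y. 2 * ennreal (norm (f x) * norm (f y) * G (x - y)) \<partial>lborel \<partial>lborel)"
    by (simp add: nn_integral_cmult)
  also have "\<dots> \<le> (\<integral>\<^sup>+x. \<integral>\<^sup>+y. ennreal ((norm (f x))\<^sup>2) * ennreal (G (x - y)) + ennreal ((norm (f y))\<^sup>2) * ennreal (G (x - y)) \<partial>lborel \<partial>lborel)"
  proof (intro nn_integral_mono)
    fix x y
    have "2 * (norm (f x) * norm (f y) * G (x - y)) \<le> (norm (f x))\<^sup>2 * G (x - y) + (norm (f y))\<^sup>2 * G (x - y)"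
      using mult_right_mono[OF sum_squares_bound[of "norm (f x)" "norm (f y)"] G0[of "x - y"]]
      by (simp add: algebra_simps)
    then have "ennreal (2 * (norm (f x) * norm (f y) * G (x - y))) \<le> ennreal ((norm (f x))\<^sup>2 * G (x - y) + (norm (f y))\<^sup>2 * G (x - y))"
      by (rule ennreal_leI)
    then show "2 * ennreal (norm (f x) * norm (f y) * G (x - y)) \<le> ennreal ((norm (f x))\<^sup>2) * ennreal (G (x - y)) + ennreal ((norm (f y))\<^sup>2) * ennreal (G (x - y))"
      using G0 by (simp add: ennreal_mult)
  qed
  also have "\<dots> = (\<integral>\<^sup>+x. \<integral>\<^sup>+y. ennreal ((norm (f x))\<^sup>2) * ennreal (G (x - y)) \<partial>lborel \<partial>lborel)
       + (\<integral>\<^sup>+x. \<integral>\<^sup>+y. ennreal ((norm (f y))\<^sup>2) * ennreal (G (x - y)) \<partial>lborel \<partial>lborel)"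
    by (simp add: nn_integral_add)
  also have "(\<integral>\<^sup>+x. \<integral>\<^sup>+y. ennreal ((norm (f y))\<^sup>2) * ennreal (G (x - y)) \<partial>lborel \<partial>lborel)
     = (\<integral>\<^sup>+y. \<integral>\<^sup>+x. ennreal ((norm (f y))\<^sup>2) * ennreal (G (x - y)) \<partial>lborel \<partial>lborel)"
    by (rule lborel_pair.Fubini') measurable
  finally have "2 * ?L \<le> 2 * ?A"
    by (simp add: nn_integral_cmult Gx Gy mult_2)
  then show ?thesis by (subst (asm) ennreal_mult_le_mult_iff) auto
qed

text \<open>
  Against a Gaussian cutoff, \<open>\<integral> |fourier f|\<^sup>2 * gauss (\<epsilon> *\<^sub>R \<xi>)\<close> is an absolutely convergent triple
  integral. Integrating over \<open>\<xi>\<close> first turns the cutoff into the nonnegative kernel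
  \<open>G\<close> of mass one, and Schur's test bounds the result by the square of the norm of \<open>f\<close>, uniformly in
  \<open>\<epsilon>\<close>. Fatou's lemma removes the cutoff.
\<close>

lemma Plancherel_inequality:
  fixes f :: "real ^ 'n \<Rightarrow> complex"
  assumes f: "integrable lborel f"
  shows "(\<integral>\<^sup>+\<xi>. ennreal ((norm (fourier f \<xi>))\<^sup>2) \<partial>lborel) \<le> (\<integral>\<^sup>+x. ennreal ((norm (f x))\<^sup>2) \<partial>lborel)"
    (is "_ \<le> ?A")
proof -
  have [measurable]: "f \<in> borel_measurable borel" using borel_measurable_integrable[OF f] by simp
  have [measurable]: "fourier f \<in> borel_measurable borel" by (rule borel_measurable_fourier) measurable
  have reg: "(\<integral>\<^sup>+\<xi>. ennreal ((norm (fourier f \<xi>))\<^sup>2 * gauss (\<epsilon> *\<^sub>R \<xi>)) \<partial>lborel) \<le> ?A" if \<epsilon>: "\<epsilon> > 0" for \<epsilon> :: real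
  proof -
    obtain G :: "real ^ 'n \<Rightarrow> real" where [measurable]: "G \<in> borel_measurable borel" and G0: "\<And>z. 0 \<le> G z"
      and G1: "(\<integral>\<^sup>+z. ennreal (G z) \<partial>lborel) = 1"
      and G: "\<And>z. fourier (\<lambda>\<xi>. of_real (gauss (\<epsilon> *\<^sub>R \<xi>))) z = of_real (G z)"
      using fourier_gauss[OF \<epsilon>] by blast
    define K :: "real ^ 'n \<Rightarrow> complex" where "K \<xi> = of_real (gauss (\<epsilon> *\<^sub>R \<xi>))" for \<xi>
    have [measurable]: "K \<in> borel_measurable borel" unfolding K_def[abs_def] by measurable
    have K: "integrable lborel K"
    proof (unfold integrable_iff_bounded, intro conjI)
      have "(\<integral>\<^sup>+\<xi>. ennreal (norm (K \<xi>)) \<partial>lborel) = (\<integral>\<^sup>+\<xi>. ennreal (gauss (\<epsilon> *\<^sub>R \<xi>)) \<partial>(lborel :: (real ^ 'n) measure))"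
        by (simp add: K_def gauss_nonneg)
      also have "\<dots> < \<infinity>"
        using \<epsilon> by (subst nn_integral_lborel_scaleR[where f="\<lambda>x. ennreal (gauss x)"]) (auto simp: nn_integral_gauss ennreal_mult_less_top)
      finally show "(\<integral>\<^sup>+\<xi>. ennreal (norm (K \<xi>)) \<partial>lborel) < \<infinity>" .
    qed measurable
    define h where "h \<xi> = cnj (fourier f \<xi>) * K \<xi>" for \<xi>
    define B where "B = (\<integral>x. norm (f x) \<partial>lborel)"
    have B: "norm (fourier f \<xi>) \<le> B" for \<xi>
      using integral_norm_bound[of lborel "\<lambda>x. f x * fourier_kernel x \<xi>"] by (simp add: B_def fourier_def norm_mult)
    have [measurable]: "h \<in> borel_measurable borel"
      unfolding h_def[abs_def] by (intro borel_measurable_times measurable_compose[OF _ borel_measurable_cnj]) measurable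
    have h: "integrable lborel h"
    proof (rule Bochner_Integration.integrable_bound)
      show "integrable lborel (\<lambda>\<xi>. of_real B * K \<xi>)" using K by simp
      have "0 \<le> B" by (simp add: B_def)
      then show "AE \<xi> in lborel. norm (h \<xi>) \<le> norm (of_real B * K \<xi>)"
        using B by (auto simp: h_def norm_mult intro!: mult_right_mono)
    qed measurable
    \<comment> \<open>The transform of the cut-off conjugate is a convolution with \<open>G\<close>.\<close>
    have fh: "fourier h x = (\<integral>y. cnj (f y) * of_real (G (x - y)) \<partial>lborel)" for x
    proof -
      have inner: "(\<integral>\<xi>. cnj (f y) * K \<xi> * (cnj (fourier_kernel y \<xi>) * fourier_kernel \<xi> x) \<partial>lborel) = cnj (f y) * of_real (G (x - y))" for y
      proof -
        have "cnj (fourier_kernel y \<xi>) * fourier_kernel \<xi> x = fourier_kernel \<xi> (x - y)" for \<xi>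
          by (simp add: exp_cnj inner_diff_right inner_commute algebra_simps flip: exp_add)
        then have "(\<integral>\<xi>. cnj (f y) * K \<xi> * (cnj (fourier_kernel y \<xi>) * fourier_kernel \<xi> x) \<partial>lborel)
            = cnj (f y) * fourier K (x - y)"
          unfolding fourier_def by (simp add: mult.assoc)
        then show ?thesis using G[of "x - y"] by (simp add: K_def[abs_def])
      qed
      have "fourier h x = (\<integral>\<xi>. (\<integral>y. cnj (f y) * K \<xi> * (cnj (fourier_kernel y \<xi>) * fourier_kernel \<xi> x) \<partial>lborel) \<partial>lborel)"
      proof -
        have "h \<xi> * fourier_kernel \<xi> x = (\<integral>y. cnj (f y) * K \<xi> * (cnj (fourier_kernel y \<xi>) * fourier_kernel \<xi> x) \<partial>lborel)" for \<xi>
        proof -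
          have "cnj (fourier f \<xi>) = (\<integral>y. cnj (f y * fourier_kernel y \<xi>) \<partial>lborel)"
            unfolding fourier_def by (rule Bochner_Integration.integral_cnj[symmetric])
          then have "h \<xi> * fourier_kernel \<xi> x = (\<integral>y. cnj (f y * fourier_kernel y \<xi>) * (K \<xi> * fourier_kernel \<xi> x) \<partial>lborel)"
            unfolding h_def by (simp only: mult.assoc integral_mult_left_zero)
          then show ?thesis by (simp only: complex_cnj_mult mult_ac)
        qed
        then show ?thesis unfolding fourier_def by simp
      qed
      also have "\<dots> = (\<integral>y. (\<integral>\<xi>. cnj (f y) * K \<xi> * (cnj (fourier_kernel y \<xi>) * fourier_kernel \<xi> x) \<partial>lborel) \<partial>lborel)"
        using f K by (intro integral_swap_bounded_kernel) (auto simp: norm_mult)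
      also have "\<dots> = (\<integral>y. cnj (f y) * of_real (G (x - y)) \<partial>lborel)"
        unfolding inner ..
      finally show ?thesis .
    qed
    \<comment> \<open>The multiplication formula: Fubini lets the kernel act on either factor.\<close>
    have key: "(\<integral>\<xi>. fourier f \<xi> * h \<xi> \<partial>lborel) = (\<integral>x. f x * fourier h x \<partial>lborel)"
    proof -
      have "(\<integral>\<xi>. fourier f \<xi> * h \<xi> \<partial>lborel) = (\<integral>\<xi>. (\<integral>x. f x * h \<xi> * fourier_kernel x \<xi> \<partial>lborel) \<partial>lborel)"
      proof (rule Bochner_Integration.integral_cong[OF refl])
        fix \<xi>
        have "fourier f \<xi> * h \<xi> = (\<integral>x. (f x * fourier_kernel x \<xi>) * h \<xi> \<partial>lborel)"
          unfolding fourier_def by (rule integral_mult_left_zero[symmetric])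
        then show "fourier f \<xi> * h \<xi> = (\<integral>x. f x * h \<xi> * fourier_kernel x \<xi> \<partial>lborel)"
          by (simp only: mult_ac)
      qed
      also have "\<dots> = (\<integral>x. (\<integral>\<xi>. f x * h \<xi> * fourier_kernel x \<xi> \<partial>lborel) \<partial>lborel)"
        using f h by (intro integral_swap_bounded_kernel) auto
      also have "\<dots> = (\<integral>x. f x * fourier h x \<partial>lborel)"
        unfolding fourier_def by (simp add: mult.assoc inner_commute)
      finally show ?thesis .
    qed
    have sq: "fourier f \<xi> * h \<xi> = of_real ((norm (fourier f \<xi>))\<^sup>2 * gauss (\<epsilon> *\<^sub>R \<xi>))" for \<xi>
      unfolding h_def K_def of_real_mult complex_norm_square by (simp only: mult.assoc)
    have "integrable lborel (\<lambda>\<xi>. fourier f \<xi> * h \<xi>)"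
    proof (rule Bochner_Integration.integrable_bound)
      show "integrable lborel (\<lambda>\<xi>. of_real B * h \<xi>)" using h by simp
      have "0 \<le> B" by (simp add: B_def)
      then show "AE \<xi> in lborel. norm (fourier f \<xi> * h \<xi>) \<le> norm (of_real B * h \<xi>)"
        using B by (auto simp: norm_mult intro!: mult_right_mono)
    qed measurable
    then have int: "integrable lborel (\<lambda>\<xi>. (norm (fourier f \<xi>))\<^sup>2 * gauss (\<epsilon> *\<^sub>R \<xi>))"
      unfolding sq by (simp only: complex_of_real_integrable_eq)
    have "(\<integral>\<^sup>+\<xi>. ennreal ((norm (fourier f \<xi>))\<^sup>2 * gauss (\<epsilon> *\<^sub>R \<xi>)) \<partial>lborel)
       = ennreal (\<integral>\<xi>. (norm (fourier f \<xi>))\<^sup>2 * gauss (\<epsilon> *\<^sub>R \<xi>) \<partial>lborel)"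
      using int by (intro nn_integral_eq_integral) (auto simp: gauss_nonneg)
    also have "\<dots> = ennreal (norm (\<integral>\<xi>. fourier f \<xi> * h \<xi> \<partial>lborel))"
      unfolding sq integral_complex_of_real norm_of_real by (simp add: gauss_nonneg integral_nonneg_AE)
    also have "\<dots> \<le> (\<integral>\<^sup>+x. ennreal (norm (f x * fourier h x)) \<partial>lborel)"
      unfolding key by (rule norm_integral_le_nn_integral)
    also have "\<dots> \<le> (\<integral>\<^sup>+x. \<integral>\<^sup>+y. ennreal (norm (f x) * norm (f y) * G (x - y)) \<partial>lborel \<partial>lborel)"
    proof (intro nn_integral_mono)
      fix x
      have "ennreal (norm (f x * fourier h x)) = ennreal (norm (f x)) * ennreal (norm (fourier h x))"
        by (simp add: norm_mult ennreal_mult)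
      also have "\<dots> \<le> ennreal (norm (f x)) * (\<integral>\<^sup>+y. ennreal (norm (cnj (f y) * of_real (G (x - y)))) \<partial>lborel)"
        unfolding fh by (intro mult_left_mono norm_integral_le_nn_integral) auto
      also have "\<dots> = (\<integral>\<^sup>+y. ennreal (norm (f x)) * ennreal (norm (cnj (f y) * of_real (G (x - y)))) \<partial>lborel)"
        by (intro nn_integral_cmult[symmetric]) measurable
      also have "\<dots> = (\<integral>\<^sup>+y. ennreal (norm (f x) * norm (f y) * G (x - y)) \<partial>lborel)"
        using G0 by (intro nn_integral_cong) (simp add: norm_mult mult.assoc flip: ennreal_mult)
      finally show "ennreal (norm (f x * fourier h x)) \<le> \<dots>" .
    qed
    also have "\<dots> \<le> ?A"
      by (rule Schur_test_convolution) (auto simp: G0 G1)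
    finally show ?thesis .
  qed
  \<comment> \<open>The cutoff is removed along \<open>\<epsilon> = 1 / (m + 1)\<close>.\<close>
  define F where "F m \<xi> = ennreal ((norm (fourier f \<xi>))\<^sup>2 * gauss ((1 / real (Suc m)) *\<^sub>R \<xi>))" for m \<xi>
  have [measurable]: "F m \<in> borel_measurable borel" for m unfolding F_def[abs_def] by measurable
  have lim: "(\<lambda>m. F m \<xi>) \<longlonglongrightarrow> ennreal ((norm (fourier f \<xi>))\<^sup>2)" for \<xi>
  proof -
    have "(\<lambda>m. gauss ((1 / real (Suc m)) *\<^sub>R \<xi>)) \<longlonglongrightarrow> (\<Prod>b\<in>(Basis :: (real ^ 'n) set). exp (- (0 * (\<xi> \<bullet> b))\<^sup>2 / 2))"
      unfolding gauss_def inner_scaleR_left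
      by (intro tendsto_intros LIMSEQ_Suc[OF lim_1_over_n]) auto
    then have "(\<lambda>m. (norm (fourier f \<xi>))\<^sup>2 * gauss ((1 / real (Suc m)) *\<^sub>R \<xi>)) \<longlonglongrightarrow> (norm (fourier f \<xi>))\<^sup>2 * 1"
      by (intro tendsto_mult tendsto_const) simp
    then show ?thesis unfolding F_def by (intro tendsto_ennrealI) simp
  qed
  have "(\<integral>\<^sup>+\<xi>. ennreal ((norm (fourier f \<xi>))\<^sup>2) \<partial>lborel) = (\<integral>\<^sup>+\<xi>. liminf (\<lambda>m. F m \<xi>) \<partial>lborel)"
    by (intro nn_integral_cong lim_imp_Liminf[OF _ lim, symmetric]) simp
  also have "\<dots> \<le> liminf (\<lambda>m. \<integral>\<^sup>+\<xi>. F m \<xi> \<partial>lborel)"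
    by (rule nn_integral_liminf) measurable
  also have "\<dots> \<le> ?A"
    using reg by (intro Liminf_le) (auto simp: F_def)
  finally show ?thesis .
qed

section \<open>The Hausdorff-Young inequality by Marcinkiewicz interpolation\<close>

text \<open>
  The weight in the layer cake formula; excluding \<open>0\<close> makes the integrand positive on the whole
  range.
\<close>

lemma nn_integral_powr_from_0:
  fixes e y :: real
  assumes e: "e > -1" and y: "0 \<le> y"
  shows "(\<integral>\<^sup>+s. (if 0 < s \<and> s \<le> y then ennreal (s powr e) else 0) \<partial>lborel) = ennreal (y powr (e + 1) / (e + 1))"
proof -
  have "(\<integral>\<^sup>+s. (if 0 < s \<and> s \<le> y then ennreal (s powr e) else 0) \<partial>lborel)
      = (\<integral>\<^sup>+s. ennreal (s powr e) * indicator {0..y} s \<partial>lborel)"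
    by (intro nn_integral_cong) (auto split: split_indicator simp: not_less)
  also have "\<dots> = ennreal (y powr (e + 1) / (e + 1))"
    by (rule nn_integral_has_integral_lebesgue'[OF _ has_integral_powr_from_0]) (use e y in auto)
  finally show ?thesis .
qed

text \<open>
  The weak-type estimate of Marcinkiewicz interpolation. Split \<open>f\<close> at height
  \<open>h = s powr (- 1 / (P - 1))\<close>. This height is chosen so that the \<open>L\<^sup>1\<close> norm of the large part
  is at most \<open>h powr (1 - P) = s\<close>; its transform is then bounded by \<open>s\<close>, and where
  \<open>|fourier f| \<ge> 2 * s\<close> the transform of the small part must be at least \<open>s\<close>. Chebyshev's and
  Plancherel's inequalities apply to the small part.
\<close>

lemma fourier_distribution_bound:
  fixes f :: "real ^ 'n \<Rightarrow> complex" and P s :: real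
  assumes f: "integrable lborel f" and P: "1 < P"
    and fP: "(\<integral>\<^sup>+x. ennreal (norm (f x) powr P) \<partial>lborel) \<le> 1" and s: "0 < s"
  shows "(\<integral>\<^sup>+\<xi>. (if 2 * s \<le> norm (fourier f \<xi>) then 1 else 0) \<partial>lborel)
     \<le> ennreal (s powr -2) * (\<integral>\<^sup>+x. (if norm (f x) \<le> s powr (- 1 / (P - 1)) then ennreal ((norm (f x))\<^sup>2) else 0) \<partial>lborel)"
proof -
  define h where "h = s powr (- 1 / (P - 1))"
  have h: "h > 0" using s by (simp add: h_def)
  have "- 1 / (P - 1) * (1 - P) = 1" using P by (simp add: field_simps)
  then have hP: "h powr (1 - P) = s" using s unfolding h_def powr_powr by simp
  have [measurable]: "f \<in> borel_measurable borel" using borel_measurable_integrable[OF f] by simp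
  define f1 where "f1 x = (if norm (f x) \<le> h then 0 else f x)" for x
  define f2 where "f2 x = (if norm (f x) \<le> h then f x else 0)" for x
  have [measurable]: "f1 \<in> borel_measurable borel" "f2 \<in> borel_measurable borel"
    unfolding f1_def[abs_def] f2_def[abs_def] by measurable
  have i1: "integrable lborel f1" and i2: "integrable lborel f2"
    by (rule Bochner_Integration.integrable_bound[OF f]; auto simp: f1_def f2_def)+
  have sum: "fourier f \<xi> = fourier f1 \<xi> + fourier f2 \<xi>" for \<xi>
    using fourier_add[OF i1 i2, of \<xi>] by (simp add: f1_def f2_def if_distrib cong: if_cong)
  have low: "norm (fourier f1 \<xi>) \<le> s" for \<xi>
  proof -
    have "ennreal (norm (fourier f1 \<xi>)) \<le> (\<integral>\<^sup>+x. ennreal (norm (f1 x)) \<partial>lborel)"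
      by (rule norm_fourier_le)
    also have "\<dots> \<le> (\<integral>\<^sup>+x. ennreal s * ennreal (norm (f x) powr P) \<partial>lborel)"
    proof (intro nn_integral_mono)
      fix x
      have "norm (f1 x) \<le> s * norm (f x) powr P"
      proof (cases "norm (f x) \<le> h")
        case True then show ?thesis using s by (simp add: f1_def)
      next
        case False
        have "norm (f x) = norm (f x) powr (1 - P) * norm (f x) powr P"
          using False h by (simp flip: powr_add)
        also have "\<dots> \<le> h powr (1 - P) * norm (f x) powr P"
          using False h P by (intro mult_right_mono powr_mono2') auto
        finally show ?thesis using False hP by (simp add: f1_def)
      qed
      then show "ennreal (norm (f1 x)) \<le> ennreal s * ennreal (norm (f x) powr P)"
        using s by (simp add: ennreal_leI flip: ennreal_mult)
    qed
    also have "\<dots> = ennreal s * (\<integral>\<^sup>+x. ennreal (norm (f x) powr P) \<partial>lborel)"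
      by (simp add: nn_integral_cmult)
    also have "\<dots> \<le> ennreal s * 1" by (intro mult_left_mono fP) simp
    finally show ?thesis using s by simp
  qed
  have "(\<integral>\<^sup>+\<xi>. (if 2 * s \<le> norm (fourier f \<xi>) then 1 else 0) \<partial>lborel)
    \<le> (\<integral>\<^sup>+\<xi>. ennreal (s powr -2) * ennreal ((norm (fourier f2 \<xi>))\<^sup>2) \<partial>lborel)"
  proof (intro nn_integral_mono)
    fix \<xi>
    show "(if 2 * s \<le> norm (fourier f \<xi>) then 1 else 0) \<le> ennreal (s powr -2) * ennreal ((norm (fourier f2 \<xi>))\<^sup>2)"
    proof (cases "2 * s \<le> norm (fourier f \<xi>)")
      case True
      have "s \<le> norm (fourier f2 \<xi>)"
        using True low[of \<xi>] norm_triangle_ineq[of "fourier f1 \<xi>" "fourier f2 \<xi>"] sum[of \<xi>] by simp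
      then have "s\<^sup>2 \<le> (norm (fourier f2 \<xi>))\<^sup>2" using s by (intro power_mono) auto
      then have "1 \<le> s powr -2 * (norm (fourier f2 \<xi>))\<^sup>2"
        using s by (simp add: powr_minus powr_numeral field_simps)
      then have "ennreal 1 \<le> ennreal (s powr -2 * (norm (fourier f2 \<xi>))\<^sup>2)" by (rule ennreal_leI)
      then show ?thesis using True by (simp add: ennreal_mult)
    qed simp
  qed
  also have "\<dots> = ennreal (s powr -2) * (\<integral>\<^sup>+\<xi>. ennreal ((norm (fourier f2 \<xi>))\<^sup>2) \<partial>lborel)"
    by (intro nn_integral_cmult) (use borel_measurable_fourier[of f2] in measurable)
  also have "\<dots> \<le> ennreal (s powr -2) * (\<integral>\<^sup>+x. ennreal ((norm (f2 x))\<^sup>2) \<partial>lborel)"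
    by (intro mult_left_mono Plancherel_inequality i2) simp
  also have "(\<integral>\<^sup>+x. ennreal ((norm (f2 x))\<^sup>2) \<partial>lborel) = (\<integral>\<^sup>+x. (if norm (f x) \<le> h then ennreal ((norm (f x))\<^sup>2) else 0) \<partial>lborel)"
    by (intro nn_integral_cong) (simp add: f2_def)
  finally show ?thesis by (simp add: h_def)
qed

text \<open>
  The layer cake formula writes the integral of \<open>|fourier f| powr Q\<close> through the measures of the
  level sets. Inserting the previous estimate and exchanging the integrals leaves, for each \<open>x\<close>, the
  integral of \<open>s powr (Q - 3)\<close> over \<open>s \<le> |f x| powr (1 - P)\<close>. It converges at \<open>0\<close> because
  \<open>Q > 2\<close>, and the exponents combine to \<open>|f x| powr P\<close> by \<open>(P - 1) * (Q - 2) = 2 - P\<close>.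
\<close>

lemma Hausdorff_Young_normalized:
  fixes f :: "real ^ 'n \<Rightarrow> complex" and P Q :: real
  assumes f: "integrable lborel f" and P: "1 < P" "P < 2" and Q: "1 / P + 1 / Q = 1"
    and fP: "(\<integral>\<^sup>+x. ennreal (norm (f x) powr P) \<partial>lborel) \<le> 1"
  shows "(\<integral>\<^sup>+\<xi>. ennreal (norm (fourier f \<xi>) powr Q) \<partial>lborel) \<le> ennreal (2 powr Q * Q / (Q - 2))"
proof -
  have Q_eq: "Q = P / (P - 1)" using P Q by (cases "Q = 0") (auto simp: field_simps)
  have Q2: "Q > 2" using P by (simp add: Q_eq field_simps)
  have exp: "(P - 1) * (Q - 2) = 2 - P" using P by (simp add: Q_eq field_simps)
  have [measurable]: "f \<in> borel_measurable borel" using borel_measurable_integrable[OF f] by simp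
  have [measurable]: "fourier f \<in> borel_measurable borel" by (rule borel_measurable_fourier) measurable
  let ?F = "\<lambda>\<xi>. norm (fourier f \<xi>)" and ?h = "\<lambda>s. s powr (- 1 / (P - 1))"
  have layer_cake: "ennreal (?F \<xi> powr Q)
     = ennreal (2 powr Q * Q) * (\<integral>\<^sup>+s. (if 0 < s \<and> s \<le> ?F \<xi> / 2 then ennreal (s powr (Q - 1)) else 0) \<partial>lborel)" for \<xi>
    using Q2 by (subst nn_integral_powr_from_0) (auto simp: powr_divide simp flip: ennreal_mult)
  have "(\<integral>\<^sup>+\<xi>. \<integral>\<^sup>+s. (if 0 < s \<and> s \<le> ?F \<xi> / 2 then ennreal (s powr (Q - 1)) else 0) \<partial>lborel \<partial>lborel)
     = (\<integral>\<^sup>+s. \<integral>\<^sup>+\<xi>. (if 0 < s \<and> s \<le> ?F \<xi> / 2 then ennreal (s powr (Q - 1)) else 0) \<partial>lborel \<partial>lborel)"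
    by (rule lborel_pair.Fubini') measurable
  also have "\<dots> \<le> (\<integral>\<^sup>+s. \<integral>\<^sup>+x. (if 0 < s \<and> norm (f x) \<le> ?h s then ennreal (s powr (Q - 3)) * ennreal ((norm (f x))\<^sup>2) else 0) \<partial>(lborel :: (real ^ 'n) measure) \<partial>lborel)"
  proof (rule nn_integral_mono)
    fix s :: real
    show "(\<integral>\<^sup>+\<xi>. (if 0 < s \<and> s \<le> ?F \<xi> / 2 then ennreal (s powr (Q - 1)) else 0) \<partial>lborel)
      \<le> (\<integral>\<^sup>+x. (if 0 < s \<and> norm (f x) \<le> ?h s then ennreal (s powr (Q - 3)) * ennreal ((norm (f x))\<^sup>2) else 0) \<partial>(lborel :: (real ^ 'n) measure))"
    proof (cases "0 < s")
      case True
      have "(\<integral>\<^sup>+\<xi>. (if 0 < s \<and> s \<le> ?F \<xi> / 2 then ennreal (s powr (Q - 1)) else 0) \<partial>lborel)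
         = (\<integral>\<^sup>+\<xi>. ennreal (s powr (Q - 1)) * (if 2 * s \<le> ?F \<xi> then 1 else 0) \<partial>lborel)"
        using True by (intro nn_integral_cong) auto
      also have "\<dots> = ennreal (s powr (Q - 1)) * (\<integral>\<^sup>+\<xi>. (if 2 * s \<le> ?F \<xi> then 1 else 0) \<partial>lborel)"
        by (rule nn_integral_cmult) measurable
      also have "\<dots> \<le> ennreal (s powr (Q - 1)) * (ennreal (s powr -2) *
          (\<integral>\<^sup>+x. (if norm (f x) \<le> ?h s then ennreal ((norm (f x))\<^sup>2) else 0) \<partial>lborel))"
        by (intro mult_left_mono fourier_distribution_bound f P fP True) simp
      also have "\<dots> = ennreal (s powr (Q - 3)) * (\<integral>\<^sup>+x. (if norm (f x) \<le> ?h s then ennreal ((norm (f x))\<^sup>2) else 0) \<partial>lborel)"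
        by (simp add: mult.assoc[symmetric] flip: ennreal_mult powr_add)
      also have "\<dots> = (\<integral>\<^sup>+x. ennreal (s powr (Q - 3)) * (if norm (f x) \<le> ?h s then ennreal ((norm (f x))\<^sup>2) else 0) \<partial>lborel)"
        by (rule nn_integral_cmult[symmetric]) measurable
      also have "\<dots> = (\<integral>\<^sup>+x. (if 0 < s \<and> norm (f x) \<le> ?h s then ennreal (s powr (Q - 3)) * ennreal ((norm (f x))\<^sup>2) else 0) \<partial>lborel)"
        using True by (intro nn_integral_cong) auto
      finally show ?thesis .
    qed simp
  qed
  also have "\<dots> = (\<integral>\<^sup>+x. \<integral>\<^sup>+s. (if 0 < s \<and> norm (f x) \<le> ?h s then ennreal (s powr (Q - 3)) * ennreal ((norm (f x))\<^sup>2) else 0) \<partial>lborel \<partial>(lborel :: (real ^ 'n) measure))"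
    by (rule lborel_pair.Fubini') measurable
  also have "\<dots> \<le> (\<integral>\<^sup>+x. ennreal (1 / (Q - 2)) * ennreal (norm (f x) powr P) \<partial>lborel)"
  proof (intro nn_integral_mono)
    fix x
    show "(\<integral>\<^sup>+s. (if 0 < s \<and> norm (f x) \<le> ?h s then ennreal (s powr (Q - 3)) * ennreal ((norm (f x))\<^sup>2) else 0) \<partial>lborel)
       \<le> ennreal (1 / (Q - 2)) * ennreal (norm (f x) powr P)"
    proof (cases "f x = 0")
      case True
      then show ?thesis by (simp cong: if_cong)
    next
      case False
      \<comment> \<open>The condition \<open>|f x| \<le> s powr (- 1 / (P - 1))\<close> solved for \<open>s\<close>.\<close>
      define y where "y = norm (f x) powr (1 - P)"
      have y: "y > 0" using False by (simp add: y_def)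
      have le: "s \<le> y" if "0 < s" "norm (f x) \<le> ?h s" for s
      proof -
        have "?h s powr (1 - P) \<le> y"
          unfolding y_def using that False P by (intro powr_mono2') auto
        moreover have "- 1 / (P - 1) * (1 - P) = 1" using P by (simp add: field_simps)
        ultimately show ?thesis using that unfolding powr_powr by simp
      qed
      have "(\<integral>\<^sup>+s. (if 0 < s \<and> norm (f x) \<le> ?h s then ennreal (s powr (Q - 3)) * ennreal ((norm (f x))\<^sup>2) else 0) \<partial>lborel)
         \<le> (\<integral>\<^sup>+s. (if 0 < s \<and> s \<le> y then ennreal (s powr (Q - 3)) else 0) * ennreal ((norm (f x))\<^sup>2) \<partial>lborel)"
        using le by (intro nn_integral_mono) auto
      also have "\<dots> = (\<integral>\<^sup>+s. (if 0 < s \<and> s \<le> y then ennreal (s powr (Q - 3)) else 0) \<partial>lborel) * ennreal ((norm (f x))\<^sup>2)"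
        by (rule nn_integral_multc) measurable
      also have "\<dots> = ennreal (y powr (Q - 2) / (Q - 2)) * ennreal ((norm (f x))\<^sup>2)"
        using Q2 y by (subst nn_integral_powr_from_0) auto
      also have "\<dots> = ennreal (1 / (Q - 2) * (y powr (Q - 2) * norm (f x) powr 2))"
        using Q2 False by (simp add: powr_numeral flip: ennreal_mult)
      also have "y powr (Q - 2) * norm (f x) powr 2 = norm (f x) powr ((1 - P) * (Q - 2) + 2)"
        by (simp add: y_def powr_powr powr_add)
      also have "(1 - P) * (Q - 2) + 2 = P" using exp by (simp add: algebra_simps)
      finally show ?thesis using Q2 by (subst ennreal_mult[symmetric]) auto
    qed
  qed
  also have "\<dots> = ennreal (1 / (Q - 2)) * (\<integral>\<^sup>+x. ennreal (norm (f x) powr P) \<partial>lborel)"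
    by (rule nn_integral_cmult) measurable
  also have "\<dots> \<le> ennreal (1 / (Q - 2)) * 1" by (intro mult_left_mono fP) simp
  finally have inner: "(\<integral>\<^sup>+\<xi>. \<integral>\<^sup>+s. (if 0 < s \<and> s \<le> ?F \<xi> / 2 then ennreal (s powr (Q - 1)) else 0) \<partial>lborel \<partial>lborel)
     \<le> ennreal (1 / (Q - 2)) * 1" .
  have "(\<integral>\<^sup>+\<xi>. ennreal (?F \<xi> powr Q) \<partial>lborel)
     = ennreal (2 powr Q * Q) * (\<integral>\<^sup>+\<xi>. \<integral>\<^sup>+s. (if 0 < s \<and> s \<le> ?F \<xi> / 2 then ennreal (s powr (Q - 1)) else 0) \<partial>lborel \<partial>lborel)"
    unfolding layer_cake by (rule nn_integral_cmult) measurable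
  also have "\<dots> \<le> ennreal (2 powr Q * Q) * (ennreal (1 / (Q - 2)) * 1)"
    by (intro mult_left_mono inner) simp
  also have "\<dots> = ennreal (2 powr Q * Q / (Q - 2))" using Q2 by (simp flip: ennreal_mult)
  finally show ?thesis .
qed

text \<open>
  The case \<open>u = 1\<close> is trivial, \<open>u = 1/2\<close> is Plancherel's inequality, and in between
  the normalized estimate applies to \<open>f / a\<close>.
\<close>

lemma Hausdorff_Young:
  assumes u: "1 / 2 \<le> u" "u \<le> 1"
  obtains C where "C \<ge> 0" "\<And>(f :: real ^ 'n \<Rightarrow> complex) a. Lp_le u f a \<Longrightarrow> Lp_le (1 - u) (fourier f) (C * a)"
proof -
  note result = that
  \<comment> \<open>Non-integrable \<open>f\<close> and bounds \<open>a = 0\<close>, where normalization is impossible, give a vanishing transform.\<close>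
  have reduce: "thesis" if C: "C \<ge> 0" and
    *: "\<And>(f :: real ^ 'n \<Rightarrow> complex) a. integrable lborel f \<Longrightarrow> 0 < a \<Longrightarrow> Lp_le u f a \<Longrightarrow> Lp_le (1 - u) (fourier f) (C * a)" for C
  proof (rule result[OF C])
    fix f :: "real ^ 'n \<Rightarrow> complex" and a
    assume f: "Lp_le u f a"
    have [measurable]: "f \<in> borel_measurable borel" using Lp_le_measurable[OF f] .
    have a: "0 \<le> a" using Lp_le_nonneg[OF f] .
    consider "\<not> integrable lborel f" | "a = 0" | "integrable lborel f" "0 < a" using a by fastforce
    then show "Lp_le (1 - u) (fourier f) (C * a)"
    proof cases
      case 1
      then show ?thesis using a C by (intro Lp_le_AE_zeroI) (auto simp: fourier_not_integrable)
    next
      case 2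
      have "AE x in lborel. f x = 0" using f u unfolding 2 by (intro Lp_le_zero_AE) auto
      then have "fourier f \<xi> = 0" for \<xi>
        unfolding fourier_def by (intro integral_eq_zero_AE) (auto elim!: eventually_mono)
      then show ?thesis using a C by (intro Lp_le_AE_zeroI borel_measurable_fourier) auto
    next
      case 3
      then show ?thesis using * f by blast
    qed
  qed
  consider "u = 1" | "u = 1 / 2" | "1 / 2 < u" "u < 1" using u by linarith
  then show thesis
  proof cases
    case 1
    show thesis
    proof (rule reduce[of 1])
      fix f :: "real ^ 'n \<Rightarrow> complex" and a :: real
      assume f: "Lp_le u f a" and a: "0 < a"
      have "norm (fourier f \<xi>) \<le> a" for \<xi>
      proof -
        have "(\<integral>\<^sup>+x. ennreal (norm (f x)) \<partial>lborel) \<le> ennreal a" using Lp_le_integral[OF f] a 1 by simp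
        then have "ennreal (norm (fourier f \<xi>)) \<le> ennreal a" by (rule order_trans[OF norm_fourier_le])
        then show ?thesis using a by simp
      qed
      then show "Lp_le (1 - u) (fourier f) (1 * a)"
        using 1 a Lp_le_measurable[OF f] by (simp add: Lp_le_def borel_measurable_fourier)
    qed simp
  next
    case 2
    show thesis
    proof (rule reduce[of 1])
      fix f :: "real ^ 'n \<Rightarrow> complex" and a :: real
      assume int: "integrable lborel f" and f: "Lp_le u f a" and a: "0 < a"
      have "(\<integral>\<^sup>+\<xi>. ennreal ((norm (fourier f \<xi>))\<^sup>2) \<partial>lborel) \<le> (\<integral>\<^sup>+x. ennreal ((norm (f x))\<^sup>2) \<partial>lborel)"
        by (rule Plancherel_inequality[OF int])
      also have "\<dots> \<le> ennreal (a\<^sup>2)" using Lp_le_integral[OF f] 2 a by (simp add: powr_numeral)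
      finally show "Lp_le (1 - u) (fourier f) (1 * a)"
        unfolding 2 using a Lp_le_measurable[OF f] by (simp add: Lp_le_def borel_measurable_fourier powr_numeral)
    qed simp
  next
    case 3
    define P Q where "P = 1 / u" and "Q = 1 / (1 - u)"
    have P: "1 < P" "P < 2" and Q: "2 < Q" and PQ: "1 / P + 1 / Q = 1"
      using 3 by (auto simp: P_def Q_def field_simps)
    define C where "C = (2 powr Q * Q / (Q - 2)) powr (1 / Q)"
    show thesis
    proof (rule reduce[of C])
      show "0 \<le> C" by (simp add: C_def)
      fix f :: "real ^ 'n \<Rightarrow> complex" and a :: real
      assume int: "integrable lborel f" and f: "Lp_le u f a" and a: "0 < a"
      have [measurable]: "f \<in> borel_measurable borel" using Lp_le_measurable[OF f] .
      have [measurable]: "fourier f \<in> borel_measurable borel" by (rule borel_measurable_fourier) measurable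
      let ?g = "\<lambda>x. of_real (1 / a) * f x"
      have "(\<integral>\<^sup>+x. ennreal (norm (?g x) powr P) \<partial>lborel) \<le> 1"
        using Lp_le_normalized[OF f _ a] 3 a by (simp add: P_def norm_mult norm_divide)
      then have "(\<integral>\<^sup>+\<xi>. ennreal (norm (fourier ?g \<xi>) powr Q) \<partial>lborel) \<le> ennreal (2 powr Q * Q / (Q - 2))"
        using int P PQ by (intro Hausdorff_Young_normalized[of ?g P Q]) auto
      also have "\<dots> = ennreal (C powr Q)"
        using Q by (simp add: C_def powr_powr)
      finally have "Lp_le (1 - u) (fourier ?g) C"
        using 3 by (simp add: Lp_le_def Q_def C_def borel_measurable_fourier)
      then have "Lp_le (1 - u) (\<lambda>\<xi>. a * norm (fourier ?g \<xi>)) (\<bar>a\<bar> * C)"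
        using 3 by (intro Lp_le_cmult) auto
      then show "Lp_le (1 - u) (fourier f) (C * a)"
      proof (rule Lp_le_mono)
        have "fourier ?g \<xi> = of_real (1 / a) * fourier f \<xi>" for \<xi> by (rule fourier_cmult)
        then show "norm (fourier f \<xi>) \<le> norm (a * norm (fourier ?g \<xi>))" for \<xi>
          using a by (simp only: norm_mult) (simp add: norm_divide)
      qed (use a 3 in auto)
    qed
  qed
qed

lemma Hausdorff_Young_inverse:
  assumes u: "1 / 2 \<le> u" "u \<le> 1"
  obtains C where "C \<ge> 0" "\<And>(f :: real ^ 'n \<Rightarrow> complex) a. Lp_le u f a \<Longrightarrow> Lp_le (1 - u) (inv_fourier f) (C * a)"
proof -
  obtain C where C: "C \<ge> 0" "\<And>(f :: real ^ 'n \<Rightarrow> complex) a. Lp_le u f a \<Longrightarrow> Lp_le (1 - u) (fourier f) (C * a)"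
    using Hausdorff_Young[OF u] by blast
  show thesis
  proof (rule that[OF C(1)])
    fix f :: "real ^ 'n \<Rightarrow> complex" and a
    assume "Lp_le u f a"
    from Lp_le_scaleR[OF C(2)[OF this], of "-1"] u
    show "Lp_le (1 - u) (inv_fourier f) (C * a)" by (simp add: inv_fourier_eq[abs_def])
  qed
qed

section \<open>Fourier transforms of derivatives of Schwartz functions\<close>

lemma partial_derivs_append: "partial_derivs (is @ js) f = partial_derivs is (partial_derivs js f)"
  by (induction "is") auto

lemma schwartz_partial_derivs:
  assumes "f \<in> schwartz" shows "partial_derivs is f \<in> schwartz"
  using assms by (auto simp: schwartz_def simp flip: partial_derivs_append)

lemma schwartz_differentiable:
  assumes "f \<in> schwartz" shows "f differentiable (at x)"
proof -
  have "\<forall>x. partial_derivs [] f differentiable (at x)" using assms unfolding schwartz_def by blast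
  then show ?thesis by simp
qed

lemma schwartz_measurable:
  assumes "f \<in> schwartz" shows "f \<in> borel_measurable borel"
  using schwartz_differentiable[OF assms]
  by (intro borel_measurable_continuous_onI continuous_at_imp_continuous_on ballI differentiable_imp_continuous_within)

text \<open>
  The seminorms control monomials; adding one factor \<open>1 + (x $ j)\<^sup>2\<close> at a time splits the weighted
  function into two with fewer factors, one of them with the exponent of \<open>x $ j\<close> raised by \<open>2\<close>.
\<close>

lemma schwartz_bounded_weighted:
  fixes f :: "real ^ 'n \<Rightarrow> complex"
  assumes f: "f \<in> schwartz" and "finite S"
  shows "bounded (range (\<lambda>x. ((\<Prod>i\<in>S. 1 + (x $ i)\<^sup>2) * (\<Prod>i\<in>UNIV. (x $ i) ^ \<alpha> i)) *\<^sub>R f x))"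
  using \<open>finite S\<close>
proof (induction S arbitrary: \<alpha>)
  case empty
  have "bounded (range (\<lambda>x. (\<Prod>i\<in>UNIV. (x $ i) ^ \<alpha> i) *\<^sub>R partial_derivs [] f x))"
    using f unfolding schwartz_def by blast
  then show ?case by simp
next
  case (insert j S)
  define \<beta> where "\<beta> i = \<alpha> i + (if i = j then 2 else 0)" for i
  have \<beta>: "(\<Prod>i\<in>UNIV. (x $ i) ^ \<beta> i) = (\<Prod>i\<in>UNIV. (x $ i) ^ \<alpha> i) * (x $ j)\<^sup>2" for x :: "real ^ 'n"
  proof -
    have "(\<Prod>i\<in>UNIV. (x $ i) ^ \<beta> i) = (\<Prod>i\<in>UNIV. (x $ i) ^ \<alpha> i) * (\<Prod>i\<in>UNIV. if i = j then (x $ i)\<^sup>2 else 1)"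
      unfolding \<beta>_def power_add prod.distrib by (intro arg_cong2[where f="(*)"] prod.cong) auto
    then show ?thesis by (simp add: prod.delta)
  qed
  have "bounded (range (\<lambda>x. ((\<Prod>i\<in>S. 1 + (x $ i)\<^sup>2) * (\<Prod>i\<in>UNIV. (x $ i) ^ \<alpha> i)) *\<^sub>R f x
      + ((\<Prod>i\<in>S. 1 + (x $ i)\<^sup>2) * (\<Prod>i\<in>UNIV. (x $ i) ^ \<beta> i)) *\<^sub>R f x))"
    by (intro bounded_plus_comp insert.IH)
  then show ?case using insert.hyps unfolding \<beta> by (simp add: algebra_simps)
qed

lemma schwartz_decay:
  fixes f :: "real ^ 'n \<Rightarrow> complex"
  assumes f: "f \<in> schwartz"
  obtains C where "0 \<le> C" "\<And>x. norm (f x) \<le> C * weight 1 x"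
proof -
  have "bounded (range (\<lambda>x. (\<Prod>i\<in>UNIV. 1 + (x $ i)\<^sup>2) *\<^sub>R f x))"
    using schwartz_bounded_weighted[OF f, of UNIV "\<lambda>_. 0"] by simp
  then obtain C where C: "0 < C" "\<And>x. norm ((\<Prod>i\<in>UNIV. 1 + (x $ i)\<^sup>2) *\<^sub>R f x) \<le> C"
    unfolding bounded_pos by auto
  show thesis
  proof (rule that)
    fix x :: "real ^ 'n"
    let ?p = "\<Prod>i\<in>UNIV. 1 + (x $ i)\<^sup>2"
    have p: "?p > 0" by (intro prod_pos) (auto simp: add_pos_nonneg)
    have "weight 1 x = 1 / ?p"
      unfolding weight_def by (simp add: powr_minus_divide prod_dividef)
    moreover have "?p * norm (f x) \<le> C" using C(2)[of x] p by simp
    ultimately show "norm (f x) \<le> C * weight 1 x" using p by (simp add: field_simps)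
  qed (use C in simp)
qed

lemma weight_integrable: "integrable lborel (\<lambda>x. C * weight 1 x)"
  using nn_integral_weight[of 1]
  by (intro integrable_mult_right) (auto simp: integrable_iff_bounded weight_nonneg)

lemma schwartz_integrable:
  assumes f: "f \<in> schwartz"
  shows "integrable lborel f"
proof -
  obtain C where "0 \<le> C" "\<And>x. norm (f x) \<le> C * weight 1 x" using schwartz_decay[OF f] by blast
  then show ?thesis
    by (intro Bochner_Integration.integrable_bound[OF weight_integrable[of C]])
       (auto simp: schwartz_measurable[OF f] weight_nonneg)
qed

text \<open>
  Makes a decay estimate uniform over unit shifts along an axis, so that it dominates difference
  quotients.
\<close>

lemma weight_translate:
  fixes x :: "real ^ 'n"
  assumes u: "\<bar>u\<bar> \<le> 1"
  shows "weight 1 (x + u *\<^sub>R axis i 1) \<le> 3 * weight 1 x"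
proof -
  have key: "(1 + (a + v)\<^sup>2) powr (- 1) \<le> 3 * (1 + a\<^sup>2) powr (- 1)" if "\<bar>v\<bar> \<le> 1" for a v :: real
  proof -
    \<comment> \<open>Completing the square: \<open>2 * (3 * (1 + (a + v)\<^sup>2) - (1 + a\<^sup>2)) = (2 * a + 3 * v)\<^sup>2 + 4 - 3 * v\<^sup>2\<close>.\<close>
    have "v\<^sup>2 \<le> 1" using that by (simp add: abs_square_le_1)
    moreover have "0 \<le> (2 * a + 3 * v)\<^sup>2" by simp
    ultimately have le: "1 + a\<^sup>2 \<le> 3 * (1 + (a + v)\<^sup>2)"
      unfolding power2_eq_square ring_distribs by linarith
    have pos: "0 < 1 + a\<^sup>2" "0 < 1 + (a + v)\<^sup>2" by (simp_all add: add_pos_nonneg)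
    have "1 / (1 + (a + v)\<^sup>2) \<le> 3 / (1 + a\<^sup>2)"
      using le pos by (simp only: pos_divide_le_eq pos_le_divide_eq times_divide_eq_left mult_1)
    then show ?thesis using pos by (simp add: powr_minus_divide)
  qed
  have "weight 1 (x + u *\<^sub>R axis i 1) = (1 + (x $ i + u)\<^sup>2) powr (- 1) * (\<Prod>j\<in>UNIV - {i}. (1 + (x $ j)\<^sup>2) powr (- 1))"
    unfolding weight_def
    by (subst prod.remove[of _ i]) (auto simp: axis_def intro!: prod.cong)
  also have "\<dots> \<le> (3 * (1 + (x $ i)\<^sup>2) powr (- 1)) * (\<Prod>j\<in>UNIV - {i}. (1 + (x $ j)\<^sup>2) powr (- 1))"
    by (intro mult_right_mono key u prod_nonneg) auto
  also have "\<dots> = 3 * weight 1 x"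
    unfolding weight_def by (subst (2) prod.remove[of _ i]) auto
  finally show ?thesis .
qed

text \<open>
  The definition of \<open>partial_deriv\<close> picks a derivative by choice; differentiability identifies it with
  the total derivative in direction \<open>axis i 1\<close>, at every point of the line.
\<close>

lemma has_vector_derivative_partial_deriv:
  fixes f :: "real ^ 'n \<Rightarrow> complex"
  assumes f: "\<And>x. f differentiable (at x)"
  shows "((\<lambda>s. f (x + s *\<^sub>R axis i 1)) has_vector_derivative partial_deriv i f (x + s *\<^sub>R axis i 1)) (at s within A)"
proof -
  have *: "((\<lambda>h. f (y + h *\<^sub>R axis i 1)) has_vector_derivative F (axis i 1)) (at h within A)"
    if "(f has_derivative F) (at (y + h *\<^sub>R axis i 1))" for y F h A
  proof -
    have "((\<lambda>h. y + h *\<^sub>R axis i 1) has_vector_derivative axis i 1) (at h within A)"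
      by (auto intro!: derivative_eq_intros)
    from vector_derivative_diff_chain_within[OF this has_derivative_at_withinI[OF that]]
    show ?thesis by (simp add: o_def)
  qed
  obtain F where F: "(f has_derivative F) (at (x + s *\<^sub>R axis i 1))"
    using f by (auto simp: differentiable_def)
  have "partial_deriv i f (x + s *\<^sub>R axis i 1) = F (axis i 1)"
    unfolding partial_deriv_def by (intro vector_derivative_at *) (use F in simp)
  then show ?thesis using *[OF F] by simp
qed

lemma has_vector_derivative_imp_difference_quotient:
  fixes g :: "real \<Rightarrow> 'a::real_normed_vector"
  assumes "(g has_vector_derivative D) (at 0)"
  shows "((\<lambda>h. (g h - g 0) /\<^sub>R h) \<longlongrightarrow> D) (at 0)"
proof -
  have "((\<lambda>h. norm (g h - g 0 - h *\<^sub>R D) / norm h) \<longlongrightarrow> 0) (at 0)"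
    using assms by (simp add: has_vector_derivative_def has_derivative_iff_norm)
  then have "((\<lambda>h. norm ((g h - g 0) /\<^sub>R h - D)) \<longlongrightarrow> 0) (at 0)"
  proof (rule Lim_transform_eventually)
    have "norm (g h - g 0 - h *\<^sub>R D) / norm h = norm ((g h - g 0) /\<^sub>R h - D)" if "h \<noteq> 0" for h
    proof -
      have "(g h - g 0) /\<^sub>R h - D = (g h - g 0 - h *\<^sub>R D) /\<^sub>R h"
        using that by (simp add: scaleR_diff_right)
      then show ?thesis by (simp add: divide_inverse mult.commute)
    qed
    then show "eventually (\<lambda>h. norm (g h - g 0 - h *\<^sub>R D) / norm h = norm ((g h - g 0) /\<^sub>R h - D)) (at 0)"
      by (auto simp: eventually_at_filter)
  qed
  then show ?thesis by (simp add: tendsto_norm_zero_iff LIM_zero_iff)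
qed

lemma fourier_translate:
  fixes f :: "real ^ 'n \<Rightarrow> complex"
  assumes [measurable]: "f \<in> borel_measurable borel"
  shows "fourier (\<lambda>x. f (x + a)) \<xi> = exp (2 * of_real pi * \<i> * of_real (a \<bullet> \<xi>)) * fourier f \<xi>"
proof -
  have "fourier f \<xi> = integral\<^sup>L (distr lborel borel ((+) a)) (\<lambda>x. f x * fourier_kernel x \<xi>)"
    by (simp add: fourier_def lborel_distr_plus)
  also have "\<dots> = (\<integral>x. f (x + a) * fourier_kernel (x + a) \<xi> \<partial>lborel)"
    by (subst integral_distr) (auto simp: add.commute)
  also have "\<dots> = (\<integral>x. exp (- 2 * of_real pi * \<i> * of_real (a \<bullet> \<xi>)) * (f (x + a) * fourier_kernel x \<xi>) \<partial>lborel)"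
    by (simp only: inner_add_left of_real_add ring_distribs exp_add mult_ac)
  also have "\<dots> = exp (- 2 * of_real pi * \<i> * of_real (a \<bullet> \<xi>)) * fourier (\<lambda>x. f (x + a)) \<xi>"
    unfolding fourier_def by (rule integral_mult_right_zero)
  finally show ?thesis by (simp add: mult.assoc[symmetric] flip: exp_add)
qed

text \<open>
  Instead of integrating by parts, one passes to the limit in difference quotients: their transforms
  are explicit by the translation rule, and the mean value inequality together with the decay of the
  partial derivative gives an integrable majorant.
\<close>

lemma fourier_partial_deriv:
  fixes f :: "real ^ 'n \<Rightarrow> complex"
  assumes f: "f \<in> schwartz"
  shows "fourier (partial_deriv i f) \<xi> = 2 * of_real pi * \<i> * of_real (\<xi> $ i) * fourier f \<xi>"
proof -
  have df: "partial_deriv i f \<in> schwartz" using schwartz_partial_derivs[OF f, of "[i]"] by simp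
  obtain C where C: "0 \<le> C" "\<And>x. norm (partial_deriv i f x) \<le> C * weight 1 x"
    using schwartz_decay[OF df] by blast
  note [measurable] = schwartz_measurable[OF f] schwartz_measurable[OF df]
  define s where "s m = 1 / real (Suc m)" for m
  have s: "0 < s m" "s m \<le> 1" for m by (auto simp: s_def)
  have s0: "s \<longlonglongrightarrow> 0" unfolding s_def by (rule LIMSEQ_Suc[OF lim_1_over_n])
  have sf: "filterlim s (at 0) sequentially"
    using s0 s(1) by (auto simp: filterlim_at less_imp_neq[symmetric])
  define D where "D m x = of_real (1 / s m) * (f (x + s m *\<^sub>R axis i 1) - f x)" for m x
  have deriv: "((\<lambda>h. f (x + h *\<^sub>R axis i 1)) has_vector_derivative partial_deriv i f (x + h *\<^sub>R axis i 1)) (at h within A)" for x h A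
    by (rule has_vector_derivative_partial_deriv) (rule schwartz_differentiable[OF f])
  have bound: "norm (D m x) \<le> C * 3 * weight 1 x" for m x
  proof -
    have "norm (f (x + s m *\<^sub>R axis i 1) - f (x + 0 *\<^sub>R axis i 1)) \<le> (C * 3 * weight 1 x) * norm (s m - 0)"
    proof (rule differentiable_bound[where S="{0..s m}" and f'="\<lambda>h k. k *\<^sub>R partial_deriv i f (x + h *\<^sub>R axis i 1)"])
      fix h assume h: "h \<in> {0..s m}"
      show "((\<lambda>h. f (x + h *\<^sub>R axis i 1)) has_derivative (\<lambda>k. k *\<^sub>R partial_deriv i f (x + h *\<^sub>R axis i 1))) (at h within {0..s m})"
        using deriv unfolding has_vector_derivative_def .
      have "norm (partial_deriv i f (x + h *\<^sub>R axis i 1)) \<le> C * weight 1 (x + h *\<^sub>R axis i 1)" by (rule C)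
      also have "\<dots> \<le> C * (3 * weight 1 x)"
        using h s(2)[of m] C(1) by (intro mult_left_mono weight_translate) auto
      finally show "onorm (\<lambda>k. k *\<^sub>R partial_deriv i f (x + h *\<^sub>R axis i 1)) \<le> C * 3 * weight 1 x"
        by (intro onorm_le) (simp add: mult_left_mono mult.commute[of _ "\<bar>_\<bar>"] mult.assoc)
    qed (use s(1)[of m] in auto)
    then show ?thesis using s(1)[of m] by (simp add: D_def norm_mult norm_divide field_simps)
  qed
  have lim: "(\<lambda>m. D m x) \<longlonglongrightarrow> partial_deriv i f x" for x
  proof -
    have "((\<lambda>h. f (x + h *\<^sub>R axis i 1)) has_vector_derivative partial_deriv i f x) (at 0)"
      using deriv[of x 0 UNIV] by simp
    then have "((\<lambda>h. (f (x + h *\<^sub>R axis i 1) - f x) /\<^sub>R h) \<longlongrightarrow> partial_deriv i f x) (at 0)"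
      using has_vector_derivative_imp_difference_quotient by fastforce
    from filterlim_compose[OF this sf] show ?thesis
      by (simp add: D_def scaleR_conv_of_real inverse_eq_divide)
  qed
  have "(\<lambda>m. fourier (D m) \<xi>) \<longlonglongrightarrow> fourier (partial_deriv i f) \<xi>"
    unfolding fourier_def
  proof (rule integral_dominated_convergence[where w="\<lambda>x. C * 3 * weight 1 x"])
    show "AE x in lborel. (\<lambda>m. D m x * fourier_kernel x \<xi>) \<longlonglongrightarrow> partial_deriv i f x * fourier_kernel x \<xi>"
      by (intro AE_I2 tendsto_intros lim)
    show "AE x in lborel. norm (D m x * fourier_kernel x \<xi>) \<le> C * 3 * weight 1 x" for m
      using bound by (simp add: norm_mult)
    show "(\<lambda>x. D m x * fourier_kernel x \<xi>) \<in> borel_measurable lborel" for m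
      unfolding D_def by measurable
    show "integrable lborel (\<lambda>x. C * 3 * weight 1 x)" by (rule weight_integrable)
  qed measurable
  moreover have "fourier (D m) \<xi> = of_real (1 / s m) * (exp (2 * of_real pi * \<i> * of_real (s m * (\<xi> $ i))) - 1) * fourier f \<xi>" for m
  proof -
    have int: "integrable lborel f" by (rule schwartz_integrable[OF f])
    have "integrable (distr lborel borel ((+) (s m *\<^sub>R axis i 1))) f" using int by (simp add: lborel_distr_plus)
    then have int': "integrable lborel (\<lambda>x. f (x + s m *\<^sub>R axis i 1))"
      by (subst (asm) integrable_distr_eq) (auto simp: add.commute)
    have "fourier (D m) \<xi> = of_real (1 / s m) * (fourier (\<lambda>x. f (x + s m *\<^sub>R axis i 1)) \<xi> - fourier f \<xi>)"
      unfolding D_def by (simp only: fourier_cmult fourier_diff[OF int' int])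
    also have "fourier (\<lambda>x. f (x + s m *\<^sub>R axis i 1)) \<xi> = exp (2 * of_real pi * \<i> * of_real (s m * (\<xi> $ i))) * fourier f \<xi>"
      by (subst fourier_translate) (auto simp: inner_commute[of "axis i 1"] cart_eq_inner_axis)
    finally show ?thesis by (simp add: algebra_simps)
  qed
  moreover have "(\<lambda>m. of_real (1 / s m) * (exp (2 * of_real pi * \<i> * of_real (s m * (\<xi> $ i))) - 1) * fourier f \<xi>)
     \<longlonglongrightarrow> 2 * of_real pi * \<i> * of_real (\<xi> $ i) * fourier f \<xi>"
  proof -
    have "((\<lambda>h::real. exp (h *\<^sub>R (2 * of_real pi * \<i> * of_real (\<xi> $ i)))) has_vector_derivative 
        2 * of_real pi * \<i> * of_real (\<xi> $ i)) (at 0)"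
      using exp_scaleR_has_vector_derivative_right[of "2 * of_real pi * \<i> * of_real (\<xi> $ i)" 0 UNIV] by simp
    then have "((\<lambda>h::real. (exp (h *\<^sub>R (2 * of_real pi * \<i> * of_real (\<xi> $ i))) - 1) /\<^sub>R h) \<longlongrightarrow> 2 * of_real pi * \<i> * of_real (\<xi> $ i)) (at 0)"
      using has_vector_derivative_imp_difference_quotient by fastforce
    from filterlim_compose[OF this sf]
    have "(\<lambda>m. of_real (1 / s m) * (exp (2 * of_real pi * \<i> * of_real (s m * (\<xi> $ i))) - 1)) \<longlonglongrightarrow> 2 * of_real pi * \<i> * of_real (\<xi> $ i)"
      by (simp add: scaleR_conv_of_real mult_ac divide_inverse)
    from tendsto_mult[OF this tendsto_const] show ?thesis .
  qed
  ultimately show ?thesis by (metis (no_types, lifting) LIMSEQ_unique ext)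
qed

text \<open>
  Induction on \<open>m\<close>: each factor \<open>|\<xi>|\<close> is at most the sum of the \<open>|\<xi> $ i|\<close>, and
  \<open>|\<xi> $ i|\<close> turns a transform into that of a partial derivative (up to the factor \<open>2 * pi > 1\<close>).
\<close>

lemma norm_power_fourier_le:
  fixes f :: "real ^ 'n \<Rightarrow> complex"
  assumes f: "f \<in> schwartz"
  shows "norm \<xi> ^ m * norm (fourier f \<xi>) \<le> (\<Sum>is | length is = m. norm (fourier (partial_derivs is f) \<xi>))"
proof (induction m)
  case 0
  show ?case by simp
next
  case (Suc m)
  have step: "\<bar>\<xi> $ i\<bar> * norm (fourier g \<xi>) \<le> norm (fourier (partial_deriv i g) \<xi>)" if g: "g \<in> schwartz" for i and g :: "real ^ 'n \<Rightarrow> complex"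
  proof -
    have "1 * (\<bar>\<xi> $ i\<bar> * norm (fourier g \<xi>)) \<le> (2 * pi) * (\<bar>\<xi> $ i\<bar> * norm (fourier g \<xi>))"
      using pi_gt3 by (intro mult_right_mono) auto
    then show ?thesis by (simp add: fourier_partial_deriv[OF g] norm_mult mult.assoc)
  qed
  let ?L = "{is :: 'n list. length is = m}"
  have "norm \<xi> ^ Suc m * norm (fourier f \<xi>) = norm \<xi> * (norm \<xi> ^ m * norm (fourier f \<xi>))" by simp
  also have "\<dots> \<le> (\<Sum>i\<in>UNIV. \<bar>\<xi> $ i\<bar>) * (\<Sum>is\<in>?L. norm (fourier (partial_derivs is f) \<xi>))"
    by (intro mult_mono Suc.IH norm_le_l1_cart sum_nonneg) auto
  also have "\<dots> = (\<Sum>i\<in>UNIV. \<Sum>is\<in>?L. \<bar>\<xi> $ i\<bar> * norm (fourier (partial_derivs is f) \<xi>))"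
    by (rule sum_product)
  also have "\<dots> \<le> (\<Sum>i\<in>UNIV. \<Sum>is\<in>?L. norm (fourier (partial_derivs (i # is) f) \<xi>))"
    using step schwartz_partial_derivs[OF f] by (intro sum_mono) simp
  also have "\<dots> = (\<Sum>(i, is)\<in>UNIV \<times> ?L. norm (fourier (partial_derivs (i # is) f) \<xi>))"
    by (rule sum.cartesian_product)
  also have "\<dots> = (\<Sum>is | length is = Suc m. norm (fourier (partial_derivs is f) \<xi>))"
    by (rule sum.reindex_bij_witness[where j="\<lambda>(i, is). i # is" and i="\<lambda>is. (hd is, tl is)"])
       (auto simp: length_Suc_conv)
  finally show ?case .
qed

lemma finite_lists_length: "finite {is :: 'n::finite list. length is = m}"
  using finite_lists_length_eq[of "UNIV :: 'n set" m] by simp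

lemma deriv_norm_measurable:
  fixes f :: "real ^ 'n \<Rightarrow> complex"
  assumes f: "f \<in> schwartz"
  shows "deriv_norm m f \<in> borel_measurable borel"
proof -
  note [measurable] = schwartz_measurable[OF schwartz_partial_derivs[OF f]]
  show ?thesis unfolding deriv_norm_def[abs_def] L2_set_def by measurable
qed

text \<open>
  The Hausdorff-Young inequality for each of the finitely many derivatives of order \<open>m\<close>.
\<close>

lemma weighted_fourier_Lp_le:
  assumes u: "1 / 2 \<le> u" "u \<le> 1"
  obtains K where "0 \<le> K" "\<And>(f :: real ^ 'n \<Rightarrow> complex) a. f \<in> schwartz \<Longrightarrow> Lp_le u (deriv_norm m f) a \<Longrightarrow>
    Lp_le (1 - u) (\<lambda>\<xi>. norm \<xi> ^ m * norm (fourier f \<xi>)) (K * a)"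
proof -
  obtain C where C: "C \<ge> 0" "\<And>(f :: real ^ 'n \<Rightarrow> complex) a. Lp_le u f a \<Longrightarrow> Lp_le (1 - u) (fourier f) (C * a)"
    using Hausdorff_Young[OF u] by blast
  let ?L = "{is :: 'n list. length is = m}"
  show thesis
  proof (rule that[of "4 ^ card ?L * C"])
    show "0 \<le> 4 ^ card ?L * C" using C by simp
    fix f :: "real ^ 'n \<Rightarrow> complex" and a
    assume f: "f \<in> schwartz" and a: "Lp_le u (deriv_norm m f) a"
    have "Lp_le (1 - u) (fourier (partial_derivs is f)) (C * a)" if "is \<in> ?L" for "is"
    proof (intro C(2) Lp_le_mono[OF a])
      show "partial_derivs is f \<in> borel_measurable borel"
        by (rule schwartz_measurable[OF schwartz_partial_derivs[OF f]])
      fix x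
      have "norm (partial_derivs is f x) \<le> deriv_norm m f x"
        unfolding deriv_norm_def using that by (intro member_le_L2_set finite_lists_length) auto
      then show "norm (partial_derivs is f x) \<le> norm (deriv_norm m f x)" by simp
    qed (use u in auto)
    then have "Lp_le (1 - u) (\<lambda>\<xi>. \<Sum>is\<in>?L. norm (fourier (partial_derivs is f) \<xi>)) (4 ^ card ?L * (C * a))"
      using u C(1) Lp_le_nonneg[OF a] by (intro Lp_le_sum finite_lists_length) auto
    then show "Lp_le (1 - u) (\<lambda>\<xi>. norm \<xi> ^ m * norm (fourier f \<xi>)) (4 ^ card ?L * C * a)"
    proof (rule Lp_le_mono)
      note [measurable] = borel_measurable_fourier[OF schwartz_measurable[OF f]]
      show "(\<lambda>\<xi>. norm \<xi> ^ m * norm (fourier f \<xi>)) \<in> borel_measurable borel" by measurable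
      show "norm (norm \<xi> ^ m * norm (fourier f \<xi>)) \<le> norm (\<Sum>is\<in>?L. norm (fourier (partial_derivs is f) \<xi>))" for \<xi>
        using norm_power_fourier_le[OF f, of \<xi> m] by (simp add: sum_nonneg)
    qed (use u in auto)
  qed
qed

section \<open>The decay estimate\<close>

lemma enn2real_inverse_exponent:
  shows "1 \<le> q \<Longrightarrow> q \<le> 2 \<Longrightarrow> 1 / 2 \<le> enn2real (1 / q) \<and> enn2real (1 / q) \<le> 1"
    and "2 \<le> p \<Longrightarrow> enn2real (1 / p) \<le> 1 / 2"
proof -
  show "1 / 2 \<le> enn2real (1 / q) \<and> enn2real (1 / q) \<le> 1" if q: "1 \<le> q" "q \<le> 2"
  proof -
    obtain Q where Q: "q = ennreal Q" "0 \<le> Q" using q(2) by (cases q) (auto simp: top_unique)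
    have "1 \<le> Q" "Q \<le> 2" using q Q by (simp_all flip: ennreal_1 ennreal_numeral)
    then show ?thesis using Q by (simp add: divide_ennreal field_simps flip: ennreal_1)
  qed
  show "enn2real (1 / p) \<le> 1 / 2" if "2 \<le> p"
  proof (cases p)
    case (real P)
    then have "2 \<le> P" using that by simp
    then show ?thesis using real by (simp add: divide_ennreal field_simps flip: ennreal_1)
  qed simp
qed

theorem corollary1p1:
  fixes p q r :: ennreal and j k l :: nat
  assumes "1 \<le> q" and "q \<le> 2" and "1 \<le> r" and "r \<le> 2" and "2 \<le> p"
    and "j \<le> k"
    and "real l > real CARD('n) * (enn2real (1 / r) - enn2real (1 / p)) \<or> (p = 2 \<and> r = 2)"
  shows "\<exists>C>0. \<forall>\<phi>\<in>(schwartz :: (real ^ 'n \<Rightarrow> complex) set). \<forall>t\<ge>0.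
    Lp_norm p (inv_fourier (\<lambda>\<xi>. of_real (norm \<xi> ^ k * exp (- eta \<xi> * t) * norm (fourier \<phi> \<xi>))))
    \<le> ennreal (C * (1 + t) powr (- gamma2 CARD('n) q p - (real k - real j) / 2))
         * Lp_norm q (deriv_norm j \<phi>)
      + ennreal (C * (1 + t) powr (- real l / 2 + gamma2 CARD('n) r p))
         * Lp_norm r (deriv_norm (k + l) \<phi>)"
proof -
  define n where "n = real CARD('n)"
  define a\<^sub>p a\<^sub>q a\<^sub>r where "a\<^sub>p = enn2real (1 / p)" and "a\<^sub>q = enn2real (1 / q)" and "a\<^sub>r = enn2real (1 / r)"
  have ap: "0 \<le> a\<^sub>p" "a\<^sub>p \<le> 1 / 2" and aq: "1 / 2 \<le> a\<^sub>q" "a\<^sub>q \<le> 1" and ar: "1 / 2 \<le> a\<^sub>r" "a\<^sub>r \<le> 1"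
    using enn2real_inverse_exponent assms(1-5) by (auto simp: a\<^sub>p_def a\<^sub>q_def a\<^sub>r_def)
  define u v where "u = a\<^sub>q - a\<^sub>p" and "v = a\<^sub>r - a\<^sub>p"
  have u: "0 \<le> u" "u \<le> 1" and v: "0 \<le> v" using ap aq ar by (auto simp: u_def v_def)
  have l: "n * v < real l \<or> v = 0"
    using assms(7) by (auto simp: n_def v_def a\<^sub>p_def a\<^sub>r_def)
  obtain C\<^sub>1 where C1: "0 \<le> C\<^sub>1" "\<And>t. 0 \<le> t \<Longrightarrow>
      Lp_le u (low_multiplier (k - j) t :: real ^ 'n \<Rightarrow> real) (C\<^sub>1 * (1 + t) powr (- (n * u / 2) - real (k - j) / 2))"
    using low_multiplier_Lp_le[OF u] unfolding n_def by metis
  obtain C\<^sub>2 where C2: "0 \<le> C\<^sub>2" "\<And>t. 0 \<le> t \<Longrightarrow>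
      Lp_le v (high_multiplier l t :: real ^ 'n \<Rightarrow> real) (C\<^sub>2 * (1 + t) powr (- (real l / 2) + n * v / 2))"
    using high_multiplier_Lp_le[OF v l[unfolded n_def]] unfolding n_def by metis
  obtain K\<^sub>1 where K1: "0 \<le> K\<^sub>1" "\<And>(\<phi> :: real ^ 'n \<Rightarrow> complex) A. \<phi> \<in> schwartz \<Longrightarrow> Lp_le a\<^sub>q (deriv_norm j \<phi>) A \<Longrightarrow>
      Lp_le (1 - a\<^sub>q) (\<lambda>\<xi>. norm \<xi> ^ j * norm (fourier \<phi> \<xi>)) (K\<^sub>1 * A)"
    using weighted_fourier_Lp_le[OF aq] by metis
  obtain K\<^sub>2 where K2: "0 \<le> K\<^sub>2" "\<And>(\<phi> :: real ^ 'n \<Rightarrow> complex) A. \<phi> \<in> schwartz \<Longrightarrow> Lp_le a\<^sub>r (deriv_norm (k + l) \<phi>) A \<Longrightarrow>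
      Lp_le (1 - a\<^sub>r) (\<lambda>\<xi>. norm \<xi> ^ (k + l) * norm (fourier \<phi> \<xi>)) (K\<^sub>2 * A)"
    using weighted_fourier_Lp_le[OF ar] by metis
  have ap': "1 / 2 \<le> 1 - a\<^sub>p" "1 - a\<^sub>p \<le> 1" using ap by auto
  obtain H where H: "0 \<le> H" "\<And>(g :: real ^ 'n \<Rightarrow> complex) A. Lp_le (1 - a\<^sub>p) g A \<Longrightarrow> Lp_le (1 - (1 - a\<^sub>p)) (inv_fourier g) (H * A)"
    using Hausdorff_Young_inverse[OF ap'] by metis
  define C where "C = 2 * H * (C\<^sub>1 * K\<^sub>1) + 2 * H * (C\<^sub>2 * K\<^sub>2) + 1"
  have C: "C > 0" "2 * H * (C\<^sub>1 * K\<^sub>1) \<le> C" "2 * H * (C\<^sub>2 * K\<^sub>2) \<le> C"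
    using C1(1) C2(1) K1(1) K2(1) H(1) by (auto simp: C_def add_nonneg_pos)
  have \<gamma>: "gamma2 CARD('n) q p = n * u / 2" "gamma2 CARD('n) r p = n * v / 2"
    by (simp_all add: gamma2_def n_def u_def v_def a\<^sub>p_def a\<^sub>q_def a\<^sub>r_def)
  show ?thesis
  proof (intro exI[of _ C] conjI C(1) ballI allI impI)
    fix \<phi> :: "real ^ 'n \<Rightarrow> complex" and t :: real
    assume \<phi>: "\<phi> \<in> schwartz" and t: "0 \<le> t"
    define \<alpha> \<beta> where "\<alpha> = (1 + t) powr (- (n * u / 2) - real (k - j) / 2)" and "\<beta> = (1 + t) powr (- (real l / 2) + n * v / 2)"
    have \<alpha>\<beta>: "0 < \<alpha>" "0 < \<beta>" using t by (auto simp: \<alpha>_def \<beta>_def)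
    let ?A = "Lp_norm q (deriv_norm j \<phi>)" and ?B = "Lp_norm r (deriv_norm (k + l) \<phi>)"
    let ?g = "\<lambda>\<xi>. complex_of_real (norm \<xi> ^ k * exp (- eta \<xi> * t) * norm (fourier \<phi> \<xi>))"
    have main: "Lp_norm p (inv_fourier ?g) \<le> ennreal (C * \<alpha>) * ?A + ennreal (C * \<beta>) * ?B"
    \<comment> \<open>An infinite norm makes the right-hand side infinite, since the coefficients are positive.\<close>
    proof (cases "?A = \<infinity> \<or> ?B = \<infinity>")
      case True
      then show ?thesis using C(1) \<alpha>\<beta> by (auto simp: ennreal_mult_top)
    next
      case False
      define A B where "A = enn2real ?A" and "B = enn2real ?B"
      have AB: "?A = ennreal A" "?B = ennreal B" "0 \<le> A" "0 \<le> B" using False by (auto simp: A_def B_def less_top)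
      have "Lp_le a\<^sub>q (deriv_norm j \<phi>) A"
        unfolding A_def a\<^sub>q_def using False assms(1) by (intro Lp_le_Lp_norm deriv_norm_measurable \<phi>) auto
      then have low: "Lp_le (1 - a\<^sub>q) (\<lambda>\<xi>. norm \<xi> ^ j * norm (fourier \<phi> \<xi>)) (K\<^sub>1 * A)" by (rule K1(2)[OF \<phi>])
      have "Lp_le a\<^sub>r (deriv_norm (k + l) \<phi>) B"
        unfolding B_def a\<^sub>r_def using False assms(3) by (intro Lp_le_Lp_norm deriv_norm_measurable \<phi>) auto
      then have high: "Lp_le (1 - a\<^sub>r) (\<lambda>\<xi>. norm \<xi> ^ (k + l) * norm (fourier \<phi> \<xi>)) (K\<^sub>2 * B)" by (rule K2(2)[OF \<phi>])
      let ?L = "\<lambda>\<xi>. low_multiplier (k - j) t \<xi> * (norm \<xi> ^ j * norm (fourier \<phi> \<xi>))"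
      let ?H = "\<lambda>\<xi>. high_multiplier l t \<xi> * (norm \<xi> ^ (k + l) * norm (fourier \<phi> \<xi>))"
      have "Lp_le (u + (1 - a\<^sub>q)) ?L ((C\<^sub>1 * \<alpha>) * (K\<^sub>1 * A))"
        unfolding \<alpha>_def by (intro Lp_le_Holder C1(2) low u(1) t) (use aq in auto)
      then have L: "Lp_le (1 - a\<^sub>p) ?L ((C\<^sub>1 * \<alpha>) * (K\<^sub>1 * A))" by (simp add: u_def)
      have "Lp_le (v + (1 - a\<^sub>r)) ?H ((C\<^sub>2 * \<beta>) * (K\<^sub>2 * B))"
        unfolding \<beta>_def by (intro Lp_le_Holder C2(2) high v t) (use ar in auto)
      then have Hi: "Lp_le (1 - a\<^sub>p) ?H ((C\<^sub>2 * \<beta>) * (K\<^sub>2 * B))" by (simp add: v_def)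
      have "Lp_le (1 - a\<^sub>p) (\<lambda>\<xi>. norm (?L \<xi>) + norm (?H \<xi>)) (2 * ((C\<^sub>1 * \<alpha>) * (K\<^sub>1 * A) + (C\<^sub>2 * \<beta>) * (K\<^sub>2 * B)))"
        using ap by (intro Lp_le_add L Hi) auto
      then have "Lp_le (1 - a\<^sub>p) ?g (2 * ((C\<^sub>1 * \<alpha>) * (K\<^sub>1 * A) + (C\<^sub>2 * \<beta>) * (K\<^sub>2 * B)))"
      proof (rule Lp_le_mono)
        note [measurable] = borel_measurable_fourier[OF schwartz_measurable[OF \<phi>]]
        show "?g \<in> borel_measurable borel" by measurable
        fix \<xi> :: "real ^ 'n"
        \<comment> \<open>The two multipliers have disjoint supports.\<close>
        have "norm (?g \<xi>) = ?L \<xi> + ?H \<xi>"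
        proof (cases "norm \<xi> \<le> 1")
          case True
          have "norm \<xi> ^ k = norm \<xi> ^ (k - j) * norm \<xi> ^ j" using assms(6) by (simp flip: power_add)
          then show ?thesis using True by (simp add: low_multiplier_def high_multiplier_def norm_mult norm_power)
        next
          case False
          then have "norm \<xi> \<noteq> 0" by auto
          then show ?thesis using False by (simp add: low_multiplier_def high_multiplier_def power_add norm_mult norm_power)
        qed
        then show "norm (?g \<xi>) \<le> norm (norm (?L \<xi>) + norm (?H \<xi>))" by simp
      qed (use ap in auto)
      from H(2)[OF this] have "Lp_norm p (inv_fourier ?g) \<le> ennreal (H * (2 * ((C\<^sub>1 * \<alpha>) * (K\<^sub>1 * A) + (C\<^sub>2 * \<beta>) * (K\<^sub>2 * B))))"
        using assms(5) by (intro Lp_norm_le) (auto simp: a\<^sub>p_def intro: order_trans[of 1 2 p])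
      also have "\<dots> \<le> ennreal (C * \<alpha> * A + C * \<beta> * B)"
      proof (rule ennreal_leI)
        have "H * (2 * ((C\<^sub>1 * \<alpha>) * (K\<^sub>1 * A) + (C\<^sub>2 * \<beta>) * (K\<^sub>2 * B))) 
            = (2 * H * (C\<^sub>1 * K\<^sub>1)) * (\<alpha> * A) + (2 * H * (C\<^sub>2 * K\<^sub>2)) * (\<beta> * B)"
          by (simp add: algebra_simps)
        also have "\<dots> \<le> C * (\<alpha> * A) + C * (\<beta> * B)"
          using C \<alpha>\<beta> AB(3,4) by (intro add_mono mult_right_mono) auto
        finally show "H * (2 * ((C\<^sub>1 * \<alpha>) * (K\<^sub>1 * A) + (C\<^sub>2 * \<beta>) * (K\<^sub>2 * B))) \<le> C * \<alpha> * A + C * \<beta> * B"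
          by (simp add: mult.assoc)
      qed
      also have "\<dots> = ennreal (C * \<alpha>) * ?A + ennreal (C * \<beta>) * ?B"
        unfolding AB(1,2) using C(1) \<alpha>\<beta> AB(3,4) by (simp add: ennreal_mult)
      finally show ?thesis .
    qed
    have "\<alpha> = (1 + t) powr (- gamma2 CARD('n) q p - (real k - real j) / 2)"
      unfolding \<alpha>_def \<gamma> using assms(6) by (simp add: of_nat_diff)
    moreover have "\<beta> = (1 + t) powr (- real l / 2 + gamma2 CARD('n) r p)"
      unfolding \<beta>_def \<gamma> by simp
    ultimately show "Lp_norm p (inv_fourier ?g)
      \<le> ennreal (C * (1 + t) powr (- gamma2 CARD('n) q p - (real k - real j) / 2)) * ?A
        + ennreal (C * (1 + t) powr (- real l / 2 + gamma2 CARD('n) r p)) * ?B"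
      using main by simp
  qed
qed

end
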